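(* Let $Z\in\mathbb{M}_n$, let $J\in\mathbb{M}_n^+$, and let $\Phi:\mathbb{M}_n\to\mathbb{M}_m$ be a positive linear map. If $|Z|\le J$ and $|Z^*|\le J$, then there exists a unitary $V\in\mathbb{M}_m$ such that $$|\Phi(Z)|\le \frac{\Phi(J)+V\Phi(J)V^*}{2}.$$
   Context: $\mathbb{M}_n$ is the space of complex $n\times n$ matrices and $\mathbb{M}_n^+$ its cone of positive semi-definite matrices. For Hermitian matrices, $A\le B$ means that $B-A$ is positive semi-definite. For $A\in\mathbb{M}_n$, $|A|=(A^*A)^{1/2}$. A linear map $\Phi:\mathbb{M}_n\to\mathbb{M}_m$ is positive if $\Phi(\mathbb{M}_n^+)\subset\mathbb{M}_m^+$. *)

theory Defs
  imports "Jordan_Normal_Form.Schur_Decomposition" "Jordan_Normal_Form.VS_Connect"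
begin

definition hermitian_mat :: "nat \<Rightarrow> complex mat \<Rightarrow> bool" where
  "hermitian_mat n A \<longleftrightarrow> A \<in> carrier_mat n n \<and> mat_adjoint A = A"

(* \<le> on complex numbers is the order of HOL-Library.Complex_Order, so
   0 \<le> z means that z is real and nonnegative; (A v) \<bullet>c v is v^* A v. *)
definition psd_mat :: "nat \<Rightarrow> complex mat \<Rightarrow> bool" where
  "psd_mat n A \<longleftrightarrow> hermitian_mat n A \<and> (\<forall>v\<in>carrier_vec n. 0 \<le> (A *\<^sub>v v) \<bullet>c v)"

definition loewner_le :: "nat \<Rightarrow> complex mat \<Rightarrow> complex mat \<Rightarrow> bool" where
  "loewner_le n A B \<longleftrightarrow> hermitian_mat n A \<and> hermitian_mat n B \<and> psd_mat n (B - A)"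

definition unitary_mat :: "nat \<Rightarrow> complex mat \<Rightarrow> bool" where
  "unitary_mat n U \<longleftrightarrow> U \<in> carrier_mat n n \<and>
     mat_adjoint U * U = 1\<^sub>m n \<and> U * mat_adjoint U = 1\<^sub>m n"

(* The unique positive semidefinite square root; meaningful for positive
   semidefinite P only. *)
definition psd_sqrt :: "complex mat \<Rightarrow> complex mat" where
  "psd_sqrt P = (THE B. psd_mat (dim_row P) B \<and> B * B = P)"

definition mat_abs :: "complex mat \<Rightarrow> complex mat" where
  "mat_abs A = psd_sqrt (mat_adjoint A * A)"

(* Matrices of all sizes share one type, so a map from n x n to m x m matrices
   is a function on that type whose values outside carrier_mat n n are irrelevant. *)
definition positive_linear_map :: "nat \<Rightarrow> nat \<Rightarrow> (complex mat \<Rightarrow> complex mat) \<Rightarrow> bool" where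
  "positive_linear_map n m \<Phi> \<longleftrightarrow>
     linear_map class_ring (module_mat TYPE(complex) n n) (module_mat TYPE(complex) m m) \<Phi> \<and>
     (\<forall>A. psd_mat n A \<longrightarrow> psd_mat m (\<Phi> A))"

end

theory Submission
  imports Defs "Jordan_Normal_Form.Spectral_Radius"
begin

text \<open>Write \<open>T(X, Y)\<close> for the block matrix with rows \<open>(X, Y)\<close> and \<open>(Y\<^sup>*, X)\<close>. The theorem
  transports positivity of \<open>T(J, Z)\<close> through \<open>\<Phi>\<close> and then reads the inequality off
  \<open>T(\<Phi> J, \<Phi> Z)\<close>.

  If \<open>Z = U D V\<^sup>*\<close> is a singular value decomposition, then \<open>|Z| = V D V\<^sup>*\<close> and
  \<open>|Z\<^sup>*| = U D U\<^sup>*\<close>, so the block matrix with rows \<open>(|Z\<^sup>*|, Z)\<close> and \<open>(Z\<^sup>*, |Z|)\<close> has the quadratic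
  form \<open>\<Sum>\<^sub>i d\<^sub>i |a\<^sub>i + b\<^sub>i|\<^sup>2\<close> in suitable coordinates. The two hypotheses on \<open>J\<close> replace both
  diagonal blocks by \<open>J\<close>, hence \<open>T(J, Z) \<ge> 0\<close> (\<open>psd_toeplitz_of_abs_le\<close>).

  A map that is merely positive, not 2-positive, need not preserve positivity of block matrices.
  It does so for \<open>T(J, Z)\<close> because positive block Toeplitz matrices are separable
  (\<open>psd_toeplitz_separable\<close>). After adding \<open>e\<close> times the identity, \<open>J\<close> can be factored
  as \<open>S\<^sup>* S\<close> with \<open>S\<close> invertible, and \<open>Z = S\<^sup>* C S\<close> for a contraction \<open>C\<close>. Each singular value
  in \<open>[0,1]\<close> is the mean of a unimodular number and its conjugate, so \<open>C\<close> is the mean of two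
  unitary matrices. Diagonalizing a unitary \<open>W\<close> gives vectors \<open>a\<^sub>k\<close> and unimodular \<open>\<lambda>\<^sub>k\<close> with
  \<open>S\<^sup>* S = \<Sum>\<^sub>k a\<^sub>k a\<^sub>k\<^sup>*\<close> and \<open>S\<^sup>* W S = \<Sum>\<^sub>k \<lambda>\<^sub>k a\<^sub>k a\<^sub>k\<^sup>*\<close>. On a single term positivity of \<open>\<Phi>\<close>
  suffices: with \<open>X = \<Phi> (a\<^sub>k a\<^sub>k\<^sup>*) \<ge> 0\<close>, the quadratic form of \<open>T(X, \<lambda>\<^sub>k X)\<close> at \<open>(g, h)\<close> is that of
  \<open>X\<close> at \<open>g + \<lambda>\<^sub>k h\<close> (\<open>psd_toeplitz_scalar\<close>). Summing and letting \<open>e\<close> tend to \<open>0\<close> yields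
  \<open>T(\<Phi> J, \<Phi> Z) \<ge> 0\<close> (\<open>positive_map_psd_toeplitz\<close>).

  Finally, for \<open>T(X, Y) \<ge> 0\<close> take a polar decomposition \<open>Y = W |Y|\<close> with \<open>W\<close> unitary and evaluate
  the quadratic form at \<open>(-W v, v)\<close>: this is \<open>X + W\<^sup>* X W - 2 |Y| \<ge> 0\<close>, so \<open>V = W\<^sup>*\<close> works
  (\<open>psd_toeplitz_abs_le\<close>).\<close>

section \<open>Adjoints and the complex inner product\<close>

lemma mat_adjoint_carrier [simp]:
  "A \<in> carrier_mat n k \<Longrightarrow> mat_adjoint A \<in> carrier_mat k n"
  unfolding mat_adjoint_def by auto

lemma dim_mat_adjoint [simp]:
  "dim_row (mat_adjoint A) = dim_col A" "dim_col (mat_adjoint A) = dim_row A"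
  unfolding mat_adjoint_def by auto

lemma index_mat_adjoint [simp]:
  fixes A :: "complex mat"
  shows "i < dim_col A \<Longrightarrow> j < dim_row A \<Longrightarrow> mat_adjoint A $$ (i, j) = cnj (A $$ (j, i))"
  unfolding mat_adjoint_def by (simp add: mat_of_rows_index)

lemma mat_adjoint_mat_adjoint [simp]:
  fixes A :: "complex mat"
  shows "mat_adjoint (mat_adjoint A) = A"
  by (rule eq_matI) auto

lemma mat_adjoint_mult:
  fixes A B :: "complex mat"
  assumes "A \<in> carrier_mat n k" "B \<in> carrier_mat k l"
  shows "mat_adjoint (A * B) = mat_adjoint B * mat_adjoint A"
  by (rule eq_matI) (use assms in \<open>auto simp: scalar_prod_def intro!: sum.cong\<close>)

lemma mat_adjoint_add:
  fixes A B :: "complex mat"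
  assumes "A \<in> carrier_mat n k" "B \<in> carrier_mat n k"
  shows "mat_adjoint (A + B) = mat_adjoint A + mat_adjoint B"
  by (rule eq_matI) (use assms in auto)

lemma mat_adjoint_minus:
  fixes A B :: "complex mat"
  assumes "A \<in> carrier_mat n k" "B \<in> carrier_mat n k"
  shows "mat_adjoint (A - B) = mat_adjoint A - mat_adjoint B"
  by (rule eq_matI) (use assms in auto)

lemma mat_adjoint_smult:
  fixes A :: "complex mat"
  shows "mat_adjoint (c \<cdot>\<^sub>m A) = cnj c \<cdot>\<^sub>m mat_adjoint A"
  by (rule eq_matI) auto

lemma mat_adjoint_one [simp]: "mat_adjoint (1\<^sub>m n :: complex mat) = 1\<^sub>m n"
  by (rule eq_matI) auto

lemma mat_adjoint_mat_diag [simp]: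
  "mat_adjoint (mat_diag n f :: complex mat) = mat_diag n (\<lambda>i. cnj (f i))"
  by (rule eq_matI) (auto simp: mat_diag_def)

lemma cscalar_add_left:
  fixes x y z :: "complex vec"
  assumes "x \<in> carrier_vec n" "y \<in> carrier_vec n" "z \<in> carrier_vec n"
  shows "(x + y) \<bullet>c z = x \<bullet>c z + y \<bullet>c z"
  using assms by (simp add: add_scalar_prod_distrib[of _ n])

lemma cscalar_add_right:
  fixes x y z :: "complex vec"
  assumes "x \<in> carrier_vec n" "y \<in> carrier_vec n" "z \<in> carrier_vec n"
  shows "x \<bullet>c (y + z) = x \<bullet>c y + x \<bullet>c z"
  using assms by (simp add: conjugate_add_vec[of _ n] scalar_prod_add_distrib[of _ n])

lemma cscalar_smult_left:
  fixes x y :: "complex vec"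
  assumes "x \<in> carrier_vec n" "y \<in> carrier_vec n"
  shows "(c \<cdot>\<^sub>v x) \<bullet>c y = c * (x \<bullet>c y)"
  using assms by simp

lemma cscalar_smult_right:
  fixes x y :: "complex vec"
  assumes "x \<in> carrier_vec n" "y \<in> carrier_vec n"
  shows "x \<bullet>c (c \<cdot>\<^sub>v y) = cnj c * (x \<bullet>c y)"
  using assms by (simp add: conjugate_smult_vec)

lemmas cscalar_linear =
  cscalar_add_left cscalar_add_right cscalar_smult_left cscalar_smult_right

lemma cscalar_swap:
  fixes x y :: "complex vec"
  assumes "x \<in> carrier_vec n" "y \<in> carrier_vec n"
  shows "y \<bullet>c x = cnj (x \<bullet>c y)"
  using assms by (auto simp: scalar_prod_def intro!: sum.cong)

lemma zero_smult_vec: "v \<in> carrier_vec n \<Longrightarrow> 0 \<cdot>\<^sub>v v = (0\<^sub>v n :: complex vec)"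
  by (rule eq_vecI) auto

lemma smult_vec_zero: "c \<cdot>\<^sub>v 0\<^sub>v n = (0\<^sub>v n :: complex vec)"
  by (rule eq_vecI) auto

lemma eq_smult_of_add_zero:
  fixes x v :: "complex vec"
  assumes "x + (- c) \<cdot>\<^sub>v v = 0\<^sub>v n" "x \<in> carrier_vec n" "v \<in> carrier_vec n"
  shows "x = c \<cdot>\<^sub>v v"
proof (rule eq_vecI)
  fix i assume "i < dim_vec (c \<cdot>\<^sub>v v)"
  then show "x $ i = (c \<cdot>\<^sub>v v) $ i"
    using arg_cong[OF assms(1), of "\<lambda>x. x $ i"] assms(2,3) by simp
qed (use assms in auto)

lemma cscalar_sum:
  fixes x y :: "complex vec"
  assumes "x \<in> carrier_vec n" "y \<in> carrier_vec n"
  shows "x \<bullet>c y = (\<Sum>i<n. x $ i * cnj (y $ i))"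
  using assms by (auto simp: scalar_prod_def intro!: sum.cong)

lemma cscalar_self_nonneg:
  fixes x :: "complex vec"
  shows "0 \<le> Re (x \<bullet>c x)" "Im (x \<bullet>c x) = 0"
  using conjugate_square_ge_0_vec[of x] by (simp_all add: less_eq_complex_def)

lemma cscalar_mult_mat_vec:
  fixes A :: "complex mat"
  assumes "A \<in> carrier_mat n k" "v \<in> carrier_vec k" "w \<in> carrier_vec n"
  shows "(A *\<^sub>v v) \<bullet>c w = v \<bullet>c (mat_adjoint A *\<^sub>v w)"
proof -
  have "(A *\<^sub>v v) \<bullet>c w = (\<Sum>i<n. \<Sum>j<k. A $$ (i,j) * v $ j * cnj (w $ i))"
    using assms by (auto simp: scalar_prod_def sum_distrib_right intro!: sum.cong)
  also have "\<dots> = (\<Sum>j<k. \<Sum>i<n. A $$ (i,j) * v $ j * cnj (w $ i))"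
    by (rule sum.swap)
  also have "\<dots> = v \<bullet>c (mat_adjoint A *\<^sub>v w)"
    using assms by (auto simp: scalar_prod_def sum_distrib_left mult_ac intro!: sum.cong)
  finally show ?thesis .
qed

text \<open>For square matrices the conclusion determines the inner dimension of a product, so that this and
  the next rules are usable for rewriting.\<close>

lemma square_mult_carrier [simp]:
  "A \<in> carrier_mat n n \<Longrightarrow> B \<in> carrier_mat n n \<Longrightarrow> A * B \<in> carrier_mat n n"
  by (rule mult_carrier_mat)

lemma square_mult_vec_carrier [simp]:
  "A \<in> carrier_mat n n \<Longrightarrow> v \<in> carrier_vec n \<Longrightarrow> A *\<^sub>v v \<in> carrier_vec n"
  by (rule mult_mat_vec_carrier)

lemma square_mult_one [simp]:
  fixes A :: "complex mat"
  assumes "A \<in> carrier_mat n n"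
  shows "A * 1\<^sub>m n = A" "1\<^sub>m n * A = A"
  using assms by (rule right_mult_one_mat, rule left_mult_one_mat)

lemma zero_square_mult_vec [simp]:
  "v \<in> carrier_vec n \<Longrightarrow> 0\<^sub>m n n *\<^sub>v v = (0\<^sub>v n :: complex vec)"
  by (rule eq_vecI) auto

lemma square_mult_assoc:
  fixes A B C :: "complex mat"
  assumes "A \<in> carrier_mat n n" "B \<in> carrier_mat n n" "C \<in> carrier_mat n n"
  shows "A * B * C = A * (B * C)"
  using assms by (rule assoc_mult_mat)

lemma mat_lincomb_form:
  fixes A B :: "complex mat"
  assumes "A \<in> carrier_mat n n" "B \<in> carrier_mat n n" "v \<in> carrier_vec n" "w \<in> carrier_vec n"
  shows "((a \<cdot>\<^sub>m A + b \<cdot>\<^sub>m B) *\<^sub>v v) \<bullet>c w = a * ((A *\<^sub>v v) \<bullet>c w) + b * ((B *\<^sub>v v) \<bullet>c w)"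
proof -
  have "(a \<cdot>\<^sub>m A + b \<cdot>\<^sub>m B) *\<^sub>v v = (a \<cdot>\<^sub>m A) *\<^sub>v v + (b \<cdot>\<^sub>m B) *\<^sub>v v"
    using assms by (intro add_mult_distrib_mat_vec) auto
  also have "\<dots> = a \<cdot>\<^sub>v (A *\<^sub>v v) + b \<cdot>\<^sub>v (B *\<^sub>v v)"
    using assms by (intro eq_vecI) auto
  finally show ?thesis
    using assms by (simp add: cscalar_linear[of _ n])
qed

section \<open>Hermitian and unitary matrices\<close>

lemma hermitian_form_real:
  assumes "hermitian_mat n A" "v \<in> carrier_vec n"
  shows "Im ((A *\<^sub>v v) \<bullet>c v) = 0"
proof -
  have A: "A \<in> carrier_mat n n" "mat_adjoint A = A"
    using assms by (auto simp: hermitian_mat_def)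
  have "(A *\<^sub>v v) \<bullet>c v = v \<bullet>c (A *\<^sub>v v)"
    using cscalar_mult_mat_vec[OF A(1) assms(2) assms(2)] A by simp
  also have "\<dots> = cnj ((A *\<^sub>v v) \<bullet>c v)"
    using A assms by (intro cscalar_swap[of _ n]) auto
  finally show ?thesis by (simp add: complex_eq_iff)
qed

lemma psd_mat_iff:
  "psd_mat n A \<longleftrightarrow> hermitian_mat n A \<and> (\<forall>v\<in>carrier_vec n. 0 \<le> Re ((A *\<^sub>v v) \<bullet>c v))"
  using hermitian_form_real[of n A] unfolding psd_mat_def by (auto simp: less_eq_complex_def)

lemma unitary_matD:
  assumes "unitary_mat n U"
  shows "U \<in> carrier_mat n n" "mat_adjoint U * U = 1\<^sub>m n" "U * mat_adjoint U = 1\<^sub>m n"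
  using assms by (auto simp: unitary_mat_def)

lemma unitary_matI:
  assumes "U \<in> carrier_mat n n" "mat_adjoint U * U = 1\<^sub>m n"
  shows "unitary_mat n U"
  using mat_mult_left_right_inverse[OF _ assms(1) assms(2)] assms
  by (simp add: unitary_mat_def)

lemma unitary_mult_cancel:
  assumes "unitary_mat n U" "X \<in> carrier_mat n n"
  shows "mat_adjoint U * (U * X) = X" "U * (mat_adjoint U * X) = X"
proof -
  note U = unitary_matD[OF assms(1)]
  show "mat_adjoint U * (U * X) = X"
    using square_mult_assoc[of "mat_adjoint U" n U X] U assms by simp
  show "U * (mat_adjoint U * X) = X"
    using square_mult_assoc[of U n "mat_adjoint U" X] U assms by simp
qed

lemma unitary_mult_vec_cancel:
  assumes "unitary_mat n U" "v \<in> carrier_vec n"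
  shows "mat_adjoint U *\<^sub>v (U *\<^sub>v v) = v" "U *\<^sub>v (mat_adjoint U *\<^sub>v v) = v"
proof -
  note U = unitary_matD[OF assms(1)]
  show "mat_adjoint U *\<^sub>v (U *\<^sub>v v) = v"
    using assoc_mult_mat_vec[of "mat_adjoint U" n n U n v] U assms by simp
  show "U *\<^sub>v (mat_adjoint U *\<^sub>v v) = v"
    using assoc_mult_mat_vec[of U n n "mat_adjoint U" n v] U assms by simp
qed

lemma unitary_mat_adjoint: "unitary_mat n U \<Longrightarrow> unitary_mat n (mat_adjoint U)"
  by (simp add: unitary_mat_def)

lemma unitary_mat_mult:
  assumes "unitary_mat n U" "unitary_mat n V"
  shows "unitary_mat n (U * V)"
  using unitary_matD[OF assms(1)] unitary_matD[OF assms(2)]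
    unitary_mult_cancel[OF assms(1)] unitary_mult_cancel[OF assms(2)]
  by (intro unitary_matI) (simp_all add: mat_adjoint_mult[of _ n n _ n] square_mult_assoc[of _ n])

lemma unitary_mat_diag:
  assumes "\<And>i. i < n \<Longrightarrow> cmod (f i) = 1"
  shows "unitary_mat n (mat_diag n f)"
proof (rule unitary_matI)
  have "cnj (f i) * f i = 1" if "i < n" for i
    using complex_norm_square[of "f i"] assms[OF that] by (simp add: mult.commute)
  then show "mat_adjoint (mat_diag n f) * mat_diag n f = 1\<^sub>m n"
    unfolding mat_adjoint_mat_diag mat_diag_diag
    by (intro eq_matI) (auto simp: mat_diag_def)
qed auto

section \<open>Conjugates of diagonal matrices\<close>

lemma mat_diag_mult_vec:
  fixes f :: "nat \<Rightarrow> complex"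
  assumes "v \<in> carrier_vec n"
  shows "mat_diag n f *\<^sub>v v = vec n (\<lambda>i. f i * v $ i)"
proof (rule eq_vecI)
  fix i assume "i < dim_vec (vec n (\<lambda>i. f i * v $ i))"
  then have i: "i < n" by simp
  have "(mat_diag n f *\<^sub>v v) $ i = (\<Sum>j<n. (if i = j then f j else 0) * v $ j)"
    using i assms by (auto simp: mat_diag_def scalar_prod_def intro!: sum.cong)
  also have "\<dots> = (\<Sum>j<n. if i = j then f j * v $ j else 0)"
    by (intro sum.cong) auto
  finally show "(mat_diag n f *\<^sub>v v) $ i = vec n (\<lambda>i. f i * v $ i) $ i"
    using i by simp
qed (simp add: mat_diag_def)

lemma diag_mult_diag_mult:
  fixes f g :: "nat \<Rightarrow> complex"
  assumes "M \<in> carrier_mat n n"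
  shows "mat_diag n f * (mat_diag n g * M) = mat_diag n (\<lambda>i. f i * g i) * M"
  using assms square_mult_assoc[of "mat_diag n f" n "mat_diag n g" M] by simp

lemma diag_sandwich_index:
  fixes f :: "nat \<Rightarrow> complex"
  assumes "P \<in> carrier_mat n n" "Q \<in> carrier_mat n n" "i < n" "j < n"
  shows "(P * mat_diag n f * Q) $$ (i,j) = (\<Sum>k<n. P $$ (i,k) * f k * Q $$ (k,j))"
  using assms by (subst mat_diag_mult_right[of _ n]) (auto simp: scalar_prod_def intro!: sum.cong)

lemma diag_sandwich_linear:
  fixes f g :: "nat \<Rightarrow> complex"
  assumes P: "P \<in> carrier_mat n n" and Q: "Q \<in> carrier_mat n n"
  shows "P * mat_diag n (\<lambda>i. a * f i + b * g i) * Q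
    = a \<cdot>\<^sub>m (P * mat_diag n f * Q) + b \<cdot>\<^sub>m (P * mat_diag n g * Q)"
proof (rule eq_matI)
  have c: "P * mat_diag n f * Q \<in> carrier_mat n n" for f
    using P Q by simp
  fix i j assume "i < dim_row (a \<cdot>\<^sub>m (P * mat_diag n f * Q) + b \<cdot>\<^sub>m (P * mat_diag n g * Q))"
    "j < dim_col (a \<cdot>\<^sub>m (P * mat_diag n f * Q) + b \<cdot>\<^sub>m (P * mat_diag n g * Q))"
  then have ij: "i < n" "j < n"
    using P Q by auto
  have "(a \<cdot>\<^sub>m (P * mat_diag n f * Q) + b \<cdot>\<^sub>m (P * mat_diag n g * Q)) $$ (i,j)
      = a * (P * mat_diag n f * Q) $$ (i,j) + b * (P * mat_diag n g * Q) $$ (i,j)"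
    using carrier_matD[OF c[of f]] carrier_matD[OF c[of g]] ij by (simp del: index_mult_mat)
  then show "(P * mat_diag n (\<lambda>i. a * f i + b * g i) * Q) $$ (i,j)
      = (a \<cdot>\<^sub>m (P * mat_diag n f * Q) + b \<cdot>\<^sub>m (P * mat_diag n g * Q)) $$ (i,j)"
    unfolding diag_sandwich_index[OF P Q ij] sum_distrib_left sum.distrib[symmetric]
    by (simp add: distrib_left distrib_right mult_ac)
qed (use P Q in auto)

lemma unitary_diag_form:
  fixes f :: "nat \<Rightarrow> complex"
  assumes U: "U \<in> carrier_mat n n" and V: "V \<in> carrier_mat n n"
    and v: "v \<in> carrier_vec n" and w: "w \<in> carrier_vec n"
  shows "((U * mat_diag n f * mat_adjoint V) *\<^sub>v v) \<bullet>c w =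
    (\<Sum>i<n. f i * (mat_adjoint V *\<^sub>v v) $ i * cnj ((mat_adjoint U *\<^sub>v w) $ i))"
proof -
  note [simp] = assms
  have Vv: "mat_adjoint V *\<^sub>v v \<in> carrier_vec n" and Uw: "mat_adjoint U *\<^sub>v w \<in> carrier_vec n"
    by (auto intro!: square_mult_vec_carrier)
  have "(U * mat_diag n f * mat_adjoint V) *\<^sub>v v = U *\<^sub>v (mat_diag n f *\<^sub>v (mat_adjoint V *\<^sub>v v))"
    using Vv by (simp add: assoc_mult_mat_vec[of _ n n _ n])
  also have "\<dots> \<bullet>c w = (mat_diag n f *\<^sub>v (mat_adjoint V *\<^sub>v v)) \<bullet>c (mat_adjoint U *\<^sub>v w)"
    using Vv by (intro cscalar_mult_mat_vec[of _ n n]) (auto intro!: square_mult_vec_carrier[of _ n])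
  finally show ?thesis
    using Vv Uw by (simp add: mat_diag_mult_vec cscalar_sum[of _ n])
qed

lemma diag_conjugate_psd:
  assumes U: "U \<in> carrier_mat n n" and d: "\<forall>i<n. 0 \<le> d i"
  shows "psd_mat n (U * mat_diag n (\<lambda>i. complex_of_real (d i)) * mat_adjoint U)"
  unfolding psd_mat_iff hermitian_mat_def
proof (intro conjI ballI)
  show "U * mat_diag n (\<lambda>i. complex_of_real (d i)) * mat_adjoint U \<in> carrier_mat n n"
    using U by simp
  show "mat_adjoint (U * mat_diag n (\<lambda>i. complex_of_real (d i)) * mat_adjoint U)
      = U * mat_diag n (\<lambda>i. complex_of_real (d i)) * mat_adjoint U"
    using U by (simp add: mat_adjoint_mult[of _ n n _ n] square_mult_assoc[of _ n])
  fix v :: "complex vec" assume v: "v \<in> carrier_vec n"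
  have "0 \<le> Re (complex_of_real (d i) * z * cnj z)" if "i < n" for i z
  proof -
    have "Re (complex_of_real (d i) * z * cnj z) = d i * ((Re z)\<^sup>2 + (Im z)\<^sup>2)"
      by (simp add: power2_eq_square algebra_simps)
    then show ?thesis
      using d[rule_format, OF that] by simp
  qed
  then show "0 \<le> Re (((U * mat_diag n (\<lambda>i. complex_of_real (d i)) * mat_adjoint U) *\<^sub>v v) \<bullet>c v)"
    unfolding unitary_diag_form[OF U U v v] Re_sum by (intro sum_nonneg) blast
qed

section \<open>Spectral theorem for normal matrices and singular values\<close>

lemma unit_vector_scaling:
  fixes v :: "complex vec"
  assumes "v \<in> carrier_vec n" "v \<noteq> 0\<^sub>v n"
  shows "\<exists>c. c \<noteq> 0 \<and> (c \<cdot>\<^sub>v v) \<bullet>c (c \<cdot>\<^sub>v v) = 1"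
proof -
  define r where "r = Re (v \<bullet>c v)"
  have vv: "v \<bullet>c v = of_real r"
    using cscalar_self_nonneg[of v] by (simp add: r_def complex_eq_iff)
  moreover have "v \<bullet>c v \<noteq> 0"
    using assms by simp
  ultimately have r: "r > 0"
    using cscalar_self_nonneg[of v] by (auto simp: r_def less_le)
  define c :: complex where "c = of_real (1 / sqrt r)"
  have "(c \<cdot>\<^sub>v v) \<bullet>c (c \<cdot>\<^sub>v v) = c * cnj c * of_real r"
    using assms vv by (simp add: cscalar_linear[of _ n])
  also have "\<dots> = of_real (1 / sqrt r * (1 / sqrt r) * r)"
    by (simp only: c_def complex_cnj_complex_of_real of_real_mult)
  also have "1 / sqrt r * (1 / sqrt r) * r = 1"
    using r by (simp add: field_simps)
  finally show ?thesis
    using r by (intro exI[of _ c]) (simp add: c_def)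
qed

text \<open>Normalizing a Gram-Schmidt basis that starts with \<open>v\<close> leaves \<open>v\<close> itself unchanged, since it is
  already a unit vector.\<close>

lemma unitary_first_column:
  fixes v :: "complex vec"
  assumes v: "v \<in> carrier_vec n" and unit: "v \<bullet>c v = 1"
  shows "\<exists>U. unitary_mat n U \<and> col U 0 = v"
proof -
  interpret cof_vec_space n "TYPE(complex)" .
  have v0: "v \<noteq> 0\<^sub>v n"
    using unit v by auto
  have n: "n > 0"
    using v v0 by (cases n) auto
  define ws where "ws = gram_schmidt n (basis_completion v)"
  note b = basis_completion[OF v v0]
  have ws: "set ws \<subseteq> carrier_vec n" "corthogonal ws" "length ws = n"
    using gram_schmidt_result[OF b(2) b(4) b(5) ws_def] b(6) by auto
  have "hd ws = v"
    unfolding ws_def basis_completion_def Let_def using v by simp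
  then have ws0: "ws ! 0 = v"
    using ws n by (metis hd_conv_nth length_greater_0_conv)
  have wi: "ws ! i \<in> carrier_vec n" if "i < n" for i
    using ws that by auto
  have wi0: "ws ! i \<noteq> 0\<^sub>v n" if "i < n" for i
    using corthogonalD[OF ws(2), of i i] ws that wi[OF that] by auto
  have "\<exists>c. (c \<cdot>\<^sub>v ws ! i) \<bullet>c (c \<cdot>\<^sub>v ws ! i) = 1 \<and> (i = 0 \<longrightarrow> c = 1)" if "i < n" for i
    using unit_vector_scaling[OF wi[OF that] wi0[OF that]] unit ws0 v
    by (cases "i = 0") (auto intro: exI[of _ 1])
  then obtain c where c: "\<And>i. i < n \<Longrightarrow> (c i \<cdot>\<^sub>v ws ! i) \<bullet>c (c i \<cdot>\<^sub>v ws ! i) = 1"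
    and c0: "c 0 = 1"
    using n by metis
  define U where "U = mat_of_cols n (map (\<lambda>i. c i \<cdot>\<^sub>v ws ! i) [0..<n])"
  have U: "U \<in> carrier_mat n n"
    by (auto simp: U_def)
  have colU: "col U i = c i \<cdot>\<^sub>v ws ! i" if "i < n" for i
    using that wi unfolding U_def by (subst col_mat_of_cols) auto
  have "mat_adjoint U * U = 1\<^sub>m n"
  proof (rule eq_matI)
    fix i j assume "i < dim_row (1\<^sub>m n :: complex mat)" "j < dim_col (1\<^sub>m n :: complex mat)"
    then have ij: "i < n" "j < n" by auto
    have "(mat_adjoint U * U) $$ (i,j) = col U j \<bullet>c col U i"
      using U ij by (auto simp: scalar_prod_def mult.commute intro!: sum.cong)
    also have "\<dots> = 1\<^sub>m n $$ (i,j)"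
    proof (cases "i = j")
      case True
      then show ?thesis using c ij colU by simp
    next
      case False
      then have "ws ! j \<bullet>c ws ! i = 0"
        using corthogonalD[OF ws(2), of j i] ws ij by auto
      then show ?thesis
        using ij wi False by (simp add: colU cscalar_linear[of _ n])
    qed
    finally show "(mat_adjoint U * U) $$ (i,j) = 1\<^sub>m n $$ (i,j)" .
  qed (use U in auto)
  then have "unitary_mat n U"
    using U by (rule unitary_matI[rotated])
  moreover have "col U 0 = v"
    using colU[OF n] c0 ws0 by simp
  ultimately show ?thesis by blast
qed

text \<open>Carries the inductions on the dimension: splitting off one pair of singular vectors leaves a
  matrix of this shape.\<close>

definition border :: "complex \<Rightarrow> complex mat \<Rightarrow> complex mat" where
  "border a X = four_block_mat (Matrix.mat 1 1 (\<lambda>_. a)) (0\<^sub>m 1 (dim_col X)) (0\<^sub>m (dim_row X) 1) X"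

lemma border_carrier [simp]:
  "X \<in> carrier_mat n n \<Longrightarrow> border a X \<in> carrier_mat (Suc n) (Suc n)"
  by (auto simp: border_def)

lemma border_mult:
  assumes "X \<in> carrier_mat n n" "Y \<in> carrier_mat n n"
  shows "border a X * border b Y = border (a * b) (X * Y)"
proof -
  have "Matrix.mat 1 1 (\<lambda>_. a) * Matrix.mat 1 1 (\<lambda>_. b) = Matrix.mat 1 1 (\<lambda>_. a * b)"
    by (rule eq_matI) (auto simp: scalar_prod_def)
  with assms show ?thesis
    unfolding border_def
    by (subst mult_four_block_mat[of _ 1 1 _ n _ n]) auto
qed

lemma mat_adjoint_border:
  assumes "X \<in> carrier_mat n n"
  shows "mat_adjoint (border a X) = border (cnj a) (mat_adjoint X)"
  by (rule eq_matI) (use assms in \<open>auto simp: border_def\<close>)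

lemma border_inject:
  assumes "border a X = border b Y" "X \<in> carrier_mat n n" "Y \<in> carrier_mat n n"
  shows "X = Y"
proof (rule eq_matI)
  fix i j assume "i < dim_row Y" "j < dim_col Y"
  then show "X $$ (i,j) = Y $$ (i,j)"
    using arg_cong[OF assms(1), of "\<lambda>M. M $$ (Suc i, Suc j)"] assms(2,3)
    by (auto simp: border_def)
qed (use assms in auto)

lemma border_one: "border 1 (1\<^sub>m n) = 1\<^sub>m (Suc n)"
  by (rule eq_matI) (auto simp: border_def)

lemma border_mat_diag: "border a (mat_diag n f) = mat_diag (Suc n) (case_nat a f)"
  by (rule eq_matI) (auto simp: border_def mat_diag_def split: nat.splits)

lemma unitary_border:
  assumes "unitary_mat n U"
  shows "unitary_mat (Suc n) (border 1 U)"
  using unitary_matD[OF assms]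
  by (intro unitary_matI) (simp_all add: mat_adjoint_border[of _ n] border_mult[of _ n] border_one)

lemma border_of_first_column:
  assumes B: "B \<in> carrier_mat (Suc n) (Suc n)"
    and "col B 0 = a \<cdot>\<^sub>v unit_vec (Suc n) 0"
    and "col (mat_adjoint B) 0 = cnj a \<cdot>\<^sub>v unit_vec (Suc n) 0"
  shows "\<exists>X\<in>carrier_mat n n. B = border a X"
proof (intro bexI)
  let ?X = "Matrix.mat n n (\<lambda>(i,j). B $$ (Suc i, Suc j))"
  have c: "B $$ (i, 0) = (if i = 0 then a else 0)" if "i < Suc n" for i
    using arg_cong[OF assms(2), of "\<lambda>x. x $ i"] B that by (auto simp: unit_vec_def)
  have r: "B $$ (0, i) = (if i = 0 then a else 0)" if "i < Suc n" for i
    using arg_cong[OF assms(3), of "\<lambda>x. cnj (x $ i)"] B that by (auto simp: unit_vec_def)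
  show "B = border a ?X"
  proof (rule eq_matI)
    fix i j assume "i < dim_row (border a ?X)" "j < dim_col (border a ?X)"
    then show "B $$ (i,j) = border a ?X $$ (i,j)"
      using c[of i] r[of j] by (cases i; cases j) (auto simp: border_def)
  qed (use B in \<open>auto simp: border_def\<close>)
qed auto

lemma unitary_first_column_image:
  assumes "unitary_mat (Suc n) U"
  shows "mat_adjoint U *\<^sub>v col U 0 = unit_vec (Suc n) 0"
proof -
  note U = unitary_matD[OF assms]
  have "col (mat_adjoint U * U) 0 = mat_adjoint U *\<^sub>v col U 0"
    using U by (intro col_mult2[of _ "Suc n" "Suc n" _ "Suc n"]) auto
  with U show ?thesis by simp
qed

lemma singular_pair_first_column:
  assumes U: "unitary_mat (Suc n) U" and V: "unitary_mat (Suc n) V"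
    and A: "A \<in> carrier_mat (Suc n) (Suc n)"
    and Av: "A *\<^sub>v col V 0 = a \<cdot>\<^sub>v col U 0"
  shows "col (mat_adjoint U * (A * V)) 0 = a \<cdot>\<^sub>v unit_vec (Suc n) 0"
proof -
  note [simp] = unitary_matD(1)[OF U] unitary_matD(1)[OF V] A
  have "col (mat_adjoint U * (A * V)) 0 = mat_adjoint U *\<^sub>v (A *\<^sub>v col V 0)"
    by (subst col_mult2[of _ "Suc n" "Suc n" _ "Suc n"], auto)
       (subst col_mult2[of _ "Suc n" "Suc n" _ "Suc n"], auto)
  also have "\<dots> = a \<cdot>\<^sub>v (mat_adjoint U *\<^sub>v col U 0)"
    unfolding Av using unitary_matD(1)[OF U] carrier_matD[OF unitary_matD(1)[OF U]]
    by (intro mult_mat_vec[of _ "Suc n" "Suc n"] carrier_vecI) simp_all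
  finally show ?thesis
    using unitary_first_column_image[OF U] by simp
qed

text \<open>The common inductive step for the spectral theorem (where \<open>U = V\<close>) and the singular value
  decomposition. The equation for \<open>A\<close> clears the first column below the corner, the one for the
  adjoint clears the first row.\<close>

lemma singular_pair_reduction:
  assumes U: "unitary_mat (Suc n) U" and V: "unitary_mat (Suc n) V"
    and A: "A \<in> carrier_mat (Suc n) (Suc n)"
    and Av: "A *\<^sub>v col V 0 = a \<cdot>\<^sub>v col U 0"
    and Au: "mat_adjoint A *\<^sub>v col U 0 = cnj a \<cdot>\<^sub>v col V 0"
  shows "\<exists>X\<in>carrier_mat n n. mat_adjoint U * (A * V) = border a X"
proof (rule border_of_first_column)
  note [simp] = unitary_matD(1)[OF U] unitary_matD(1)[OF V] A
  show "col (mat_adjoint U * (A * V)) 0 = a \<cdot>\<^sub>v unit_vec (Suc n) 0"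
    by (rule singular_pair_first_column[OF U V A Av])
  have "mat_adjoint (mat_adjoint U * (A * V)) = mat_adjoint V * (mat_adjoint A * U)"
    by (simp add: mat_adjoint_mult[of _ "Suc n" "Suc n" _ "Suc n"] square_mult_assoc[of _ "Suc n"])
  then show "col (mat_adjoint (mat_adjoint U * (A * V))) 0 = cnj a \<cdot>\<^sub>v unit_vec (Suc n) 0"
    using singular_pair_first_column[OF V U _ Au] by simp
  show "mat_adjoint U * (A * V) \<in> carrier_mat (Suc n) (Suc n)"
    by (intro square_mult_carrier mat_adjoint_carrier) simp_all
qed

lemma conjugation_solve:
  assumes U: "unitary_mat n U" and V: "unitary_mat n V" and A: "A \<in> carrier_mat n n"
    and "mat_adjoint U * (A * V) = B"
  shows "A = U * B * mat_adjoint V"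
proof -
  note [simp] = unitary_matD[OF U] unitary_matD[OF V] A
  have "U * B * mat_adjoint V = U * (mat_adjoint U * (A * (V * mat_adjoint V)))"
    unfolding assms(4)[symmetric] by (simp add: square_mult_assoc[of _ n] del: unitary_matD(3)[OF V])
  also have "\<dots> = A"
    using right_mult_one_mat[OF A] by (simp add: unitary_mult_cancel[OF U])
  finally show ?thesis ..
qed

text \<open>Absorbs a diagonalization of the smaller block into the outer unitary factors.\<close>

lemma border_conjugation:
  assumes U: "U \<in> carrier_mat (Suc n) (Suc n)" and V: "V \<in> carrier_mat (Suc n) (Suc n)"
    and P: "P \<in> carrier_mat n n" and Q: "Q \<in> carrier_mat n n"
  shows "U * border a (P * mat_diag n f * mat_adjoint Q) * mat_adjoint V =
    (U * border 1 P) * mat_diag (Suc n) (case_nat a f) * mat_adjoint (V * border 1 Q)"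
proof -
  note [simp] = assms
  have "border a (P * mat_diag n f * mat_adjoint Q)
      = border 1 P * border a (mat_diag n f) * border 1 (mat_adjoint Q)"
    by (simp add: border_mult[of _ n])
  then show ?thesis
    by (simp add: border_mat_diag mat_adjoint_border[of _ n] mat_adjoint_mult[of _ "Suc n" "Suc n" _ "Suc n"]
        square_mult_assoc[of _ "Suc n"])
qed

lemma unit_eigenvector:
  fixes A :: "complex mat"
  assumes A: "A \<in> carrier_mat (Suc n) (Suc n)"
  shows "\<exists>v a. v \<in> carrier_vec (Suc n) \<and> v \<bullet>c v = 1 \<and> A *\<^sub>v v = a \<cdot>\<^sub>v v"
proof -
  obtain a where "eigenvalue A a"
    using spectrum_non_empty[OF A] by (auto simp: spectrum_def)
  then obtain v where v: "v \<in> carrier_vec (Suc n)" "v \<noteq> 0\<^sub>v (Suc n)" "A *\<^sub>v v = a \<cdot>\<^sub>v v"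
    using A by (auto simp: eigenvalue_def eigenvector_def)
  obtain c where c: "(c \<cdot>\<^sub>v v) \<bullet>c (c \<cdot>\<^sub>v v) = 1"
    using unit_vector_scaling[OF v(1,2)] by blast
  have "A *\<^sub>v (c \<cdot>\<^sub>v v) = a \<cdot>\<^sub>v (c \<cdot>\<^sub>v v)"
    using v A by (simp add: mult_mat_vec smult_smult_assoc mult.commute)
  with c v show ?thesis by (intro exI[of _ "c \<cdot>\<^sub>v v"] exI[of _ a]) simp
qed

text \<open>Normality makes \<open>A\<^sup>* v\<close> and \<open>A v\<close> equally long; expanding the square of the norm of
  \<open>A\<^sup>* v - cnj a v\<close> then gives zero.\<close>

lemma normal_adjoint_eigenvector:
  assumes A: "A \<in> carrier_mat n n" and normal: "mat_adjoint A * A = A * mat_adjoint A"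
    and v: "v \<in> carrier_vec n" and Av: "A *\<^sub>v v = a \<cdot>\<^sub>v v"
  shows "mat_adjoint A *\<^sub>v v = cnj a \<cdot>\<^sub>v v"
proof -
  let ?w = "mat_adjoint A *\<^sub>v v"
  have w: "?w \<in> carrier_vec n" using A v by (intro square_mult_vec_carrier mat_adjoint_carrier)
  have 1: "?w \<bullet>c ?w = a * cnj a * (v \<bullet>c v)"
  proof -
    have "?w \<bullet>c ?w = v \<bullet>c (A *\<^sub>v (mat_adjoint A *\<^sub>v v))"
      using cscalar_mult_mat_vec[of "mat_adjoint A" n n v ?w] A v w by simp
    also have "A *\<^sub>v (mat_adjoint A *\<^sub>v v) = mat_adjoint A *\<^sub>v (A *\<^sub>v v)"
      using A v normal assoc_mult_mat_vec[of A n n "mat_adjoint A" n v]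
        assoc_mult_mat_vec[of "mat_adjoint A" n n A n v] by simp
    also have "v \<bullet>c \<dots> = (A *\<^sub>v v) \<bullet>c (A *\<^sub>v v)"
      using cscalar_mult_mat_vec[of A n n v "A *\<^sub>v v"] A v by simp
    finally show ?thesis
      using v by (simp add: Av cscalar_linear[of _ n])
  qed
  have 2: "v \<bullet>c ?w = a * (v \<bullet>c v)"
    using cscalar_mult_mat_vec[of A n n v v] A v by (simp add: Av cscalar_linear[of _ n])
  have 3: "?w \<bullet>c v = cnj a * (v \<bullet>c v)"
    using cscalar_swap[of v n ?w] cscalar_swap[of v n v] v w 2 by simp
  let ?d = "?w + (- cnj a) \<cdot>\<^sub>v v"
  have "?d \<bullet>c ?d = 0"
    using v w by (simp add: cscalar_linear[of _ n] 1 2 3 algebra_simps)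
  then have "?d = 0\<^sub>v n"
    using conjugate_square_eq_0_vec[of ?d n] v w by (auto intro!: add_carrier_vec)
  then show ?thesis
    by (rule eq_smult_of_add_zero[OF _ w v])
qed

theorem normal_unitarily_diagonalizable:
  assumes "A \<in> carrier_mat n n" "mat_adjoint A * A = A * mat_adjoint A"
  shows "\<exists>U f. unitary_mat n U \<and> A = U * mat_diag n f * mat_adjoint U"
  using assms
proof (induction n arbitrary: A)
  case 0
  then show ?case
    by (intro exI[of _ "1\<^sub>m 0"] exI[of _ "\<lambda>_. 0"]) (auto simp: unitary_mat_def mat_diag_def intro!: eq_matI)
next
  case (Suc n)
  note A = Suc.prems(1)
  obtain v a where v: "v \<in> carrier_vec (Suc n)" "v \<bullet>c v = 1" and Av: "A *\<^sub>v v = a \<cdot>\<^sub>v v"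
    using unit_eigenvector[OF A] by blast
  obtain U where U: "unitary_mat (Suc n) U" and "col U 0 = v"
    using unitary_first_column[OF v] by blast
  then obtain X where X: "X \<in> carrier_mat n n" and "mat_adjoint U * (A * U) = border a X"
    using singular_pair_reduction[OF U U A, of a] Av
      normal_adjoint_eigenvector[OF Suc.prems v(1) Av] by auto
  note AX = conjugation_solve[OF U U A this(2)] and B = this(2)
  note [simp] = unitary_matD[OF U] A X
  have "mat_adjoint (border a X) * border a X = border a X * mat_adjoint (border a X)"
    unfolding B[symmetric] using Suc.prems(2)[symmetric] unitary_mult_cancel[OF U]
      square_mult_assoc[of A "Suc n" "mat_adjoint A" U]
      square_mult_assoc[of "mat_adjoint A" "Suc n" A U]
    by (simp add: mat_adjoint_mult[of _ "Suc n" "Suc n" _ "Suc n"] square_mult_assoc[of _ "Suc n"])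
  then have "border (cnj a * a) (mat_adjoint X * X) = border (a * cnj a) (X * mat_adjoint X)"
    by (simp add: mat_adjoint_border[of _ n] border_mult[of _ n])
  then have "mat_adjoint X * X = X * mat_adjoint X"
    by (rule border_inject[where n = n]) (auto simp: mult.commute)
  from Suc.IH[OF X this] obtain P f where P: "unitary_mat n P"
    and XP: "X = P * mat_diag n f * mat_adjoint P" by blast
  show ?case
    using AX border_conjugation[of U n U P P a f] unitary_mat_mult[OF U unitary_border[OF P]]
      unitary_matD(1)[OF P] XP by auto
qed

text \<open>Supplies the left singular vector in the case of singular value zero, where \<open>A v / d\<close> makes no
  sense. A kernel vector of \<open>A A\<^sup>*\<close> exists because the determinant vanishes, and it is already
  annihilated by \<open>A\<^sup>*\<close>.\<close>

lemma singular_adjoint_kernel: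
  fixes A :: "complex mat"
  assumes A: "A \<in> carrier_mat n n" and v: "v \<in> carrier_vec n" "v \<noteq> 0\<^sub>v n" "A *\<^sub>v v = 0\<^sub>v n"
  shows "\<exists>u. u \<in> carrier_vec n \<and> u \<bullet>c u = 1 \<and> mat_adjoint A *\<^sub>v u = 0\<^sub>v n"
proof -
  have "det A = 0"
    using det_0_iff_vec_prod_zero[OF A] v by blast
  then have "det (A * mat_adjoint A) = 0"
    using A by (subst det_mult[of _ n]) auto
  then obtain w where w: "w \<in> carrier_vec n" "w \<noteq> 0\<^sub>v n" "(A * mat_adjoint A) *\<^sub>v w = 0\<^sub>v n"
    using det_0_iff_vec_prod_zero[of "A * mat_adjoint A" n] A by auto
  have w': "mat_adjoint A *\<^sub>v w \<in> carrier_vec n"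
    using A w by (intro square_mult_vec_carrier mat_adjoint_carrier)
  have "(mat_adjoint A *\<^sub>v w) \<bullet>c (mat_adjoint A *\<^sub>v w) = w \<bullet>c (A *\<^sub>v (mat_adjoint A *\<^sub>v w))"
    using cscalar_mult_mat_vec[of "mat_adjoint A" n n w "mat_adjoint A *\<^sub>v w"] A w w' by simp
  also have "A *\<^sub>v (mat_adjoint A *\<^sub>v w) = 0\<^sub>v n"
    using w A assoc_mult_mat_vec[of A n n "mat_adjoint A" n w] by simp
  finally have Aw: "mat_adjoint A *\<^sub>v w = 0\<^sub>v n"
    using w' w by simp
  obtain c where "(c \<cdot>\<^sub>v w) \<bullet>c (c \<cdot>\<^sub>v w) = 1"
    using unit_vector_scaling[OF w(1,2)] by blast
  moreover have "mat_adjoint A *\<^sub>v (c \<cdot>\<^sub>v w) = 0\<^sub>v n"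
    using A w Aw by (simp add: mult_mat_vec[of _ n n] smult_vec_zero)
  ultimately show ?thesis
    using w by (intro exI[of _ "c \<cdot>\<^sub>v w"]) simp
qed

text \<open>Take \<open>v\<close> a unit eigenvector of \<open>A\<^sup>* A\<close>; its eigenvalue is \<open>|A v|\<^sup>2 = d\<^sup>2\<close>, and for \<open>d > 0\<close> the
  vector \<open>u = A v / d\<close> is the partner.\<close>

lemma singular_pair_exists:
  fixes A :: "complex mat"
  assumes A: "A \<in> carrier_mat (Suc n) (Suc n)"
  shows "\<exists>u v d. u \<in> carrier_vec (Suc n) \<and> u \<bullet>c u = 1 \<and> v \<in> carrier_vec (Suc n) \<and> v \<bullet>c v = 1
    \<and> d \<ge> 0 \<and> A *\<^sub>v v = complex_of_real d \<cdot>\<^sub>v u \<and> mat_adjoint A *\<^sub>v u = complex_of_real d \<cdot>\<^sub>v v"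
proof -
  let ?N = "Suc n"
  have "mat_adjoint A * A \<in> carrier_mat ?N ?N" using A by (intro mult_carrier_mat) auto
  then obtain v a where v: "v \<in> carrier_vec ?N" "v \<bullet>c v = 1"
    and "(mat_adjoint A * A) *\<^sub>v v = a \<cdot>\<^sub>v v"
    using unit_eigenvector by blast
  then have AAv: "mat_adjoint A *\<^sub>v (A *\<^sub>v v) = a \<cdot>\<^sub>v v"
    using A assoc_mult_mat_vec[of "mat_adjoint A" ?N ?N A ?N v] by simp
  have Av: "A *\<^sub>v v \<in> carrier_vec ?N" using A v by auto
  have "(A *\<^sub>v v) \<bullet>c (A *\<^sub>v v) = v \<bullet>c (a \<cdot>\<^sub>v v)"
    using cscalar_mult_mat_vec[of A ?N ?N v "A *\<^sub>v v"] A v AAv by simp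
  then have norm: "(A *\<^sub>v v) \<bullet>c (A *\<^sub>v v) = cnj a"
    using v by (simp add: cscalar_linear[of _ ?N])
  then have a: "Re a \<ge> 0" "a = of_real (Re a)"
    using cscalar_self_nonneg[of "A *\<^sub>v v"] by (auto simp: complex_eq_iff)
  show ?thesis
  proof (cases "Re a = 0")
    case True
    then have 0: "A *\<^sub>v v = 0\<^sub>v ?N"
      using norm a Av by simp
    moreover have "v \<noteq> 0\<^sub>v ?N" using v by auto
    ultimately obtain u where "u \<in> carrier_vec ?N" "u \<bullet>c u = 1" "mat_adjoint A *\<^sub>v u = 0\<^sub>v ?N"
      using singular_adjoint_kernel[OF A v(1)] by blast
    then show ?thesis
      using 0 v by (intro exI[of _ u] exI[of _ v] exI[of _ 0]) (simp add: zero_smult_vec)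
  next
    case False
    define d where "d = sqrt (Re a)"
    have d: "d > 0" and dd: "of_real d * of_real d = a"
      using a False by (auto simp: d_def simp flip: of_real_mult)
    have cnja: "cnj a = of_real d * of_real d"
      unfolding dd by (subst (1 2) a(2)) simp
    let ?c = "complex_of_real (1 / d)"
    let ?u = "?c \<cdot>\<^sub>v (A *\<^sub>v v)"
    have cd: "?c * a = of_real d" "?c * (?c * a) = 1" "of_real d * ?c = 1"
      using d by (simp_all flip: dd)
    have "?u \<bullet>c ?u = 1"
      using Av norm cnja d by (simp add: cscalar_linear[of _ ?N])
    moreover have "A *\<^sub>v v = of_real d \<cdot>\<^sub>v ?u"
      using Av cd by (simp add: smult_smult_assoc)
    moreover have "mat_adjoint A *\<^sub>v ?u = of_real d \<cdot>\<^sub>v v"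
      using A Av v cd by (simp add: mult_mat_vec[of _ ?N ?N] AAv smult_smult_assoc)
    ultimately show ?thesis
      using d v Av by (intro exI[of _ ?u] exI[of _ v] exI[of _ d]) simp
  qed
qed

theorem singular_value_decomposition:
  assumes "A \<in> carrier_mat n n"
  shows "\<exists>U V d. unitary_mat n U \<and> unitary_mat n V \<and> (\<forall>i<n. 0 \<le> d i) \<and>
    A = U * mat_diag n (\<lambda>i. complex_of_real (d i)) * mat_adjoint V"
  using assms
proof (induction n arbitrary: A)
  case 0
  then show ?case
    by (intro exI[of _ "1\<^sub>m 0"] exI[of _ "\<lambda>_. 0"]) (auto simp: unitary_mat_def mat_diag_def intro!: eq_matI)
next
  case (Suc n)
  note A = Suc.prems
  obtain u v d where uv: "u \<in> carrier_vec (Suc n)" "u \<bullet>c u = 1"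
      "v \<in> carrier_vec (Suc n)" "v \<bullet>c v = 1" and d: "d \<ge> 0"
    and Av: "A *\<^sub>v v = complex_of_real d \<cdot>\<^sub>v u"
    and Au: "mat_adjoint A *\<^sub>v u = complex_of_real d \<cdot>\<^sub>v v"
    using singular_pair_exists[OF A] by blast
  obtain U where U: "unitary_mat (Suc n) U" and cU: "col U 0 = u"
    using unitary_first_column[OF uv(1,2)] by blast
  obtain V where V: "unitary_mat (Suc n) V" and cV: "col V 0 = v"
    using unitary_first_column[OF uv(3,4)] by blast
  obtain X where X: "X \<in> carrier_mat n n" and B: "mat_adjoint U * (A * V) = border (of_real d) X"
    using singular_pair_reduction[OF U V A, of "of_real d"] Av Au cU cV by auto
  note AX = conjugation_solve[OF U V A B]
  from Suc.IH[OF X] obtain P Q f where P: "unitary_mat n P" and Q: "unitary_mat n Q"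
    and f: "\<forall>i<n. 0 \<le> f i"
    and XP: "X = P * mat_diag n (\<lambda>i. complex_of_real (f i)) * mat_adjoint Q" by blast
  have cs: "case_nat (complex_of_real d) (\<lambda>i. of_real (f i)) = (\<lambda>i. of_real (case_nat d f i))"
    by (auto split: nat.splits)
  have "A = (U * border 1 P) * mat_diag (Suc n) (\<lambda>i. of_real (case_nat d f i)) * mat_adjoint (V * border 1 Q)"
    using AX border_conjugation[of U n V P Q "of_real d" "\<lambda>i. of_real (f i)"] unitary_matD(1)[OF P]
      unitary_matD(1)[OF Q] unitary_matD(1)[OF U] unitary_matD(1)[OF V] XP
    by (simp add: cs)
  moreover have "\<forall>i<Suc n. 0 \<le> case_nat d f i"
    using d f by (auto split: nat.splits)
  ultimately show ?case
    using unitary_mat_mult[OF U unitary_border[OF P]] unitary_mat_mult[OF V unitary_border[OF Q]]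
    by blast
qed

section \<open>Absolute values\<close>

text \<open>The vector \<open>y = C v - d v\<close> satisfies \<open>C y = - d y\<close> because \<open>(C + d)(C - d) v = 0\<close>. A positive
  semidefinite \<open>C\<close> has no negative eigenvalue, so \<open>y = 0\<close> when \<open>d > 0\<close>; for \<open>d = 0\<close> the norm of
  \<open>C v\<close> vanishes directly.\<close>

lemma psd_sqrt_eigenvector:
  assumes C: "psd_mat n C" and v: "v \<in> carrier_vec n" and d: "0 \<le> d"
    and eig: "C *\<^sub>v (C *\<^sub>v v) = complex_of_real (d * d) \<cdot>\<^sub>v v"
  shows "C *\<^sub>v v = complex_of_real d \<cdot>\<^sub>v v"
proof -
  have Cc: "C \<in> carrier_mat n n" "mat_adjoint C = C"
    using C by (auto simp: psd_mat_def hermitian_mat_def)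
  note [simp] = Cc(1) v
  have Cv: "C *\<^sub>v v \<in> carrier_vec n" by simp
  define y where "y = C *\<^sub>v v + complex_of_real (- d) \<cdot>\<^sub>v v"
  have y: "y \<in> carrier_vec n" by (simp add: y_def)
  have "C *\<^sub>v y = complex_of_real (d * d) \<cdot>\<^sub>v v + complex_of_real (- d) \<cdot>\<^sub>v (C *\<^sub>v v)"
    unfolding y_def eig[symmetric]
    by (simp add: mult_add_distrib_mat_vec[of _ n n] mult_mat_vec[of _ n n])
  also have "\<dots> = complex_of_real (- d) \<cdot>\<^sub>v y"
    using Cv by (simp add: y_def smult_add_distrib_vec[of _ n] smult_smult_assoc comm_add_vec[of _ n])
  finally have Cy: "C *\<^sub>v y = complex_of_real (- d) \<cdot>\<^sub>v y" .
  have "y = 0\<^sub>v n"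
  proof (cases "d = 0")
    case True
    have "(C *\<^sub>v v) \<bullet>c (C *\<^sub>v v) = v \<bullet>c (C *\<^sub>v (C *\<^sub>v v))"
      using cscalar_mult_mat_vec[of C n n v "C *\<^sub>v v"] Cc by simp
    also have "\<dots> = 0"
      unfolding eig True by (simp add: cscalar_smult_right[of _ n])
    finally have "C *\<^sub>v v = 0\<^sub>v n"
      using conjugate_square_eq_0_vec[OF Cv] by simp
    moreover have "complex_of_real (- d) \<cdot>\<^sub>v v = 0\<^sub>v n"
      using zero_smult_vec[OF v] by (simp add: True)
    ultimately show ?thesis
      by (simp add: y_def)
  next
    case False
    have "0 \<le> Re ((C *\<^sub>v y) \<bullet>c y)"
      using C y by (simp add: psd_mat_iff)
    then have "0 \<le> - d * Re (y \<bullet>c y)"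
      unfolding Cy using y by (simp add: cscalar_smult_left[of _ n])
    then have "Re (y \<bullet>c y) = 0"
      using False d cscalar_self_nonneg(1)[of y] by (simp add: mult_le_0_iff)
    then have "y \<bullet>c y = 0"
      using cscalar_self_nonneg(2)[of y] by (simp add: complex_eq_iff)
    then show ?thesis
      using conjugate_square_eq_0_vec[OF y] by simp
  qed
  then have "C *\<^sub>v v + (- complex_of_real d) \<cdot>\<^sub>v v = 0\<^sub>v n"
    unfolding y_def of_real_minus .
  then show ?thesis
    by (rule eq_smult_of_add_zero[OF _ Cv v])
qed

lemma svd_gram:
  assumes U: "unitary_mat n U" and V: "unitary_mat n V"
    and A: "A = U * mat_diag n (\<lambda>i. complex_of_real (d i)) * mat_adjoint V"
  shows "mat_adjoint A * A = V * mat_diag n (\<lambda>i. complex_of_real (d i * d i)) * mat_adjoint V"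
proof -
  note [simp] = unitary_matD(1)[OF U] unitary_matD(1)[OF V]
  show ?thesis
    unfolding A
    by (simp add: mat_adjoint_mult[of _ n n _ n] square_mult_assoc[of _ n]
        unitary_mult_cancel[OF U] diag_mult_diag_mult)
qed

text \<open>The columns of \<open>V\<close> are eigenvectors of \<open>C\<^sup>2\<close>, hence of \<open>C\<close>, and their eigenvalues determine \<open>C\<close>.\<close>

lemma psd_sqrt_unique:
  assumes C: "psd_mat n C" and V: "unitary_mat n V" and d: "\<forall>i<n. 0 \<le> d i"
    and CC: "C * C = V * mat_diag n (\<lambda>i. complex_of_real (d i * d i)) * mat_adjoint V"
  shows "C = V * mat_diag n (\<lambda>i. complex_of_real (d i)) * mat_adjoint V"
proof -
  let ?D = "mat_diag n (\<lambda>i. complex_of_real (d i))"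
  let ?P = "V * mat_diag n (\<lambda>i. complex_of_real (d i * d i)) * mat_adjoint V"
  note Vc = unitary_matD(1)[OF V]
  have Cc: "C \<in> carrier_mat n n"
    using C by (auto simp: psd_mat_def hermitian_mat_def)
  have dims: "dim_row V = n" "dim_col V = n" "dim_row C = n" "dim_col C = n"
    using Vc Cc by auto
  have P: "?P \<in> carrier_mat n n"
    using Vc by (intro square_mult_carrier mat_adjoint_carrier mat_diag_dim)
  have PV: "?P * V = V * mat_diag n (\<lambda>i. complex_of_real (d i * d i))"
    using Vc unitary_matD(2)[OF V] right_mult_one_mat[of "mat_diag n f" n n for f :: "nat \<Rightarrow> complex"]
    by (simp add: square_mult_assoc[of _ n] del: of_real_mult)
  have "C * V = V * ?D"
  proof (rule eq_matI)
    fix i j assume "i < dim_row (V * ?D)" "j < dim_col (V * ?D)"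
    then have ij: "i < n" "j < n"
      using dims by (auto simp: mat_diag_def)
    have c: "col V j \<in> carrier_vec n"
      by (rule carrier_vecI) (simp add: dims)
    have "C *\<^sub>v (C *\<^sub>v col V j) = (C * C) *\<^sub>v col V j"
      using c Cc by (simp add: assoc_mult_mat_vec[of _ n n _ n])
    also have "\<dots> = col (?P * V) j"
      unfolding CC using col_mult2[OF P Vc ij(2)] by simp
    also have "\<dots> = col (V * mat_diag n (\<lambda>i. complex_of_real (d i * d i))) j"
      unfolding PV ..
    also have "\<dots> = complex_of_real (d j * d j) \<cdot>\<^sub>v col V j"
      unfolding mat_diag_mult_right[OF Vc] using ij dims by (intro eq_vecI) auto
    finally have "C *\<^sub>v col V j = complex_of_real (d j) \<cdot>\<^sub>v col V j"
      using psd_sqrt_eigenvector[OF C c d[rule_format, OF ij(2)]] by simp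
    then have "(C *\<^sub>v col V j) $ i = (complex_of_real (d j) \<cdot>\<^sub>v col V j) $ i"
      by simp
    then show "(C * V) $$ (i,j) = (V * ?D) $$ (i,j)"
      unfolding mat_diag_mult_right[OF Vc] using ij dims by simp
  qed (use dims in \<open>auto simp: mat_diag_def\<close>)
  then have "V * ?D * mat_adjoint V = C * V * mat_adjoint V" by simp
  also have "\<dots> = C"
    using Cc Vc unitary_matD(3)[OF V] by (simp add: square_mult_assoc[of _ n])
  finally show ?thesis ..
qed

text \<open>Both \<open>J\<close> and \<open>V D V\<^sup>*\<close> are positive semidefinite square roots of \<open>J\<^sup>2\<close>, where \<open>J = U D V\<^sup>*\<close> is a
  singular value decomposition. This gives nonnegative eigenvalues without a separate argument.\<close>

lemma psd_unitarily_diagonalizable: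
  assumes "psd_mat n J"
  shows "\<exists>V d. unitary_mat n V \<and> (\<forall>i<n. 0 \<le> d i) \<and>
    J = V * mat_diag n (\<lambda>i. complex_of_real (d i)) * mat_adjoint V"
proof -
  have J: "J \<in> carrier_mat n n" "mat_adjoint J = J"
    using assms by (auto simp: psd_mat_def hermitian_mat_def)
  obtain U V d where U: "unitary_mat n U" and V: "unitary_mat n V" and d: "\<forall>i<n. 0 \<le> d i"
    and Jeq: "J = U * mat_diag n (\<lambda>i. complex_of_real (d i)) * mat_adjoint V"
    using singular_value_decomposition[OF J(1)] by blast
  have "J * J = V * mat_diag n (\<lambda>i. complex_of_real (d i * d i)) * mat_adjoint V"
    using svd_gram[OF U V Jeq] J(2) by simp
  then have "J = V * mat_diag n (\<lambda>i. complex_of_real (d i)) * mat_adjoint V"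
    using psd_sqrt_unique[OF assms V d] by blast
  with V d show ?thesis by blast
qed

lemma mat_abs_svd:
  assumes U: "unitary_mat n U" and V: "unitary_mat n V" and d: "\<forall>i<n. 0 \<le> d i"
    and A: "A = U * mat_diag n (\<lambda>i. complex_of_real (d i)) * mat_adjoint V"
  shows "mat_abs A = V * mat_diag n (\<lambda>i. complex_of_real (d i)) * mat_adjoint V"
    (is "_ = ?B")
  unfolding mat_abs_def psd_sqrt_def
proof (rule the_equality)
  have Vc: "V \<in> carrier_mat n n" and Uc: "U \<in> carrier_mat n n"
    using U V by (simp_all add: unitary_mat_def)
  have dim: "dim_row (mat_adjoint A * A) = n"
    unfolding svd_gram[OF U V A] using Vc by simp
  have B: "psd_mat n ?B"
    by (rule diag_conjugate_psd[OF Vc d])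
  have "mat_adjoint ?B = ?B"
    using B by (simp add: psd_mat_def hermitian_mat_def)
  then have "?B * ?B = mat_adjoint A * A"
    using svd_gram[OF V V refl, of d] svd_gram[OF U V A] by simp
  then show "psd_mat (dim_row (mat_adjoint A * A)) ?B \<and> ?B * ?B = mat_adjoint A * A"
    using B dim by simp
  fix C assume C: "psd_mat (dim_row (mat_adjoint A * A)) C \<and> C * C = mat_adjoint A * A"
  then have "psd_mat n C"
    unfolding dim by blast
  moreover have "C * C = V * mat_diag n (\<lambda>i. complex_of_real (d i * d i)) * mat_adjoint V"
    using C unfolding svd_gram[OF U V A] by blast
  ultimately show "C = ?B"
    by (rule psd_sqrt_unique[OF _ V d])
qed

section \<open>Positive block Toeplitz matrices\<close>

text \<open>For Hermitian \<open>X\<close>: the quadratic form at \<open>(g, h)\<close> of the block matrix with rows \<open>(X, Y)\<close> and \<open>(Y\<^sup>*, X)\<close> is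
  nonnegative. Working with the form avoids block matrices and the adjoint of \<open>Y\<close> altogether.\<close>

definition psd_toeplitz :: "nat \<Rightarrow> complex mat \<Rightarrow> complex mat \<Rightarrow> bool" where
  "psd_toeplitz n X Y \<longleftrightarrow> (\<forall>g\<in>carrier_vec n. \<forall>h\<in>carrier_vec n.
     0 \<le> Re ((X *\<^sub>v g) \<bullet>c g) + Re ((X *\<^sub>v h) \<bullet>c h) + 2 * Re ((Y *\<^sub>v h) \<bullet>c g))"

lemma loewner_le_form:
  assumes "loewner_le n A B" "v \<in> carrier_vec n"
  shows "Re ((A *\<^sub>v v) \<bullet>c v) \<le> Re ((B *\<^sub>v v) \<bullet>c v)"
proof -
  have A: "A \<in> carrier_mat n n" and B: "B \<in> carrier_mat n n"
    using assms by (auto simp: loewner_le_def hermitian_mat_def)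
  have "((B - A) *\<^sub>v v) \<bullet>c v = (B *\<^sub>v v) \<bullet>c v - (A *\<^sub>v v) \<bullet>c v"
    using A B assms(2) by (simp add: minus_mult_distrib_mat_vec[of _ n n] minus_scalar_prod_distrib[of _ n])
  moreover have "0 \<le> Re (((B - A) *\<^sub>v v) \<bullet>c v)"
    using assms unfolding loewner_le_def psd_mat_iff by blast
  ultimately show ?thesis
    by simp
qed

text \<open>With \<open>a = U\<^sup>* g\<close> and \<open>b = V\<^sup>* h\<close>, the form with diagonal blocks \<open>|Z\<^sup>*|\<close> and \<open>|Z|\<close> is
  \<open>\<Sum>\<^sub>i d\<^sub>i |a\<^sub>i + b\<^sub>i|\<^sup>2\<close>; enlarging both blocks to \<open>J\<close> only increases it.\<close>

lemma psd_toeplitz_of_abs_le: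
  assumes Z: "Z \<in> carrier_mat n n"
    and le: "loewner_le n (mat_abs Z) J" "loewner_le n (mat_abs (mat_adjoint Z)) J"
  shows "psd_toeplitz n J Z"
  unfolding psd_toeplitz_def
proof (intro ballI)
  fix g h :: "complex vec" assume g: "g \<in> carrier_vec n" and h: "h \<in> carrier_vec n"
  obtain U V d where U: "unitary_mat n U" and V: "unitary_mat n V" and d: "\<forall>i<n. 0 \<le> d i"
    and Zeq: "Z = U * mat_diag n (\<lambda>i. complex_of_real (d i)) * mat_adjoint V"
    using singular_value_decomposition[OF Z] by blast
  note [simp] = unitary_matD(1)[OF U] unitary_matD(1)[OF V]
  have "mat_adjoint Z = V * mat_diag n (\<lambda>i. complex_of_real (d i)) * mat_adjoint U"
    unfolding Zeq by (simp add: mat_adjoint_mult[of _ n n _ n] square_mult_assoc[of _ n])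
  note absZ = mat_abs_svd[OF U V d Zeq] and absZ' = mat_abs_svd[OF V U d this]
  let ?a = "\<lambda>i. (mat_adjoint U *\<^sub>v g) $ i" and ?b = "\<lambda>i. (mat_adjoint V *\<^sub>v h) $ i"
  have form1: "Re ((mat_abs (mat_adjoint Z) *\<^sub>v g) \<bullet>c g) = (\<Sum>i<n. Re (complex_of_real (d i) * ?a i * cnj (?a i)))"
    unfolding absZ' by (subst unitary_diag_form[of _ n]) (use g in simp_all)
  have form2: "Re ((mat_abs Z *\<^sub>v h) \<bullet>c h) = (\<Sum>i<n. Re (complex_of_real (d i) * ?b i * cnj (?b i)))"
    unfolding absZ by (subst unitary_diag_form[of _ n]) (use h in simp_all)
  have form3: "Re ((Z *\<^sub>v h) \<bullet>c g) = (\<Sum>i<n. Re (complex_of_real (d i) * ?b i * cnj (?a i)))"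
    unfolding Zeq by (subst unitary_diag_form[of _ n]) (use g h in simp_all)
  have sq: "x * ((Re a + Re b)\<^sup>2 + (Im a + Im b)\<^sup>2) = Re (complex_of_real x * a * cnj a)
      + Re (complex_of_real x * b * cnj b) + 2 * Re (complex_of_real x * b * cnj a)" for a b x
    by (simp add: power2_eq_square algebra_simps)
  have "0 \<le> (\<Sum>i<n. d i * ((Re (?a i) + Re (?b i))\<^sup>2 + (Im (?a i) + Im (?b i))\<^sup>2))"
    using d by (intro sum_nonneg mult_nonneg_nonneg) auto
  also have "\<dots> = Re ((mat_abs (mat_adjoint Z) *\<^sub>v g) \<bullet>c g) + Re ((mat_abs Z *\<^sub>v h) \<bullet>c h)
      + 2 * Re ((Z *\<^sub>v h) \<bullet>c g)"
    unfolding form1 form2 form3 sum_distrib_left sum.distrib[symmetric] sq ..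
  also have "\<dots> \<le> Re ((J *\<^sub>v g) \<bullet>c g) + Re ((J *\<^sub>v h) \<bullet>c h) + 2 * Re ((Z *\<^sub>v h) \<bullet>c g)"
    using loewner_le_form[OF le(1) h] loewner_le_form[OF le(2) g] by simp
  finally show "0 \<le> \<dots>" .
qed

lemma psd_toeplitz_congruence:
  assumes "psd_toeplitz n X Y" and X: "X \<in> carrier_mat n n" and Y: "Y \<in> carrier_mat n n"
    and R: "R \<in> carrier_mat n n"
  shows "psd_toeplitz n (mat_adjoint R * X * R) (mat_adjoint R * Y * R)"
proof -
  have *: "((mat_adjoint R * M * R) *\<^sub>v v) \<bullet>c w = (M *\<^sub>v (R *\<^sub>v v)) \<bullet>c (R *\<^sub>v w)"
    if [simp]: "M \<in> carrier_mat n n" "v \<in> carrier_vec n" "w \<in> carrier_vec n" for M v w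
  proof -
    have "(mat_adjoint R * M * R) *\<^sub>v v = mat_adjoint R *\<^sub>v (M *\<^sub>v (R *\<^sub>v v))"
      using R by (simp add: assoc_mult_mat_vec[of _ n n _ n])
    then show ?thesis
      using R cscalar_mult_mat_vec[of "mat_adjoint R" n n "M *\<^sub>v (R *\<^sub>v v)" w] by simp
  qed
  show ?thesis
    using assms by (auto simp: psd_toeplitz_def *)
qed

lemma psd_toeplitz_lincomb:
  assumes T: "psd_toeplitz n X Y" "psd_toeplitz n X' Y'" and ab: "0 \<le> a" "0 \<le> b"
    and c: "X \<in> carrier_mat n n" "Y \<in> carrier_mat n n" "X' \<in> carrier_mat n n" "Y' \<in> carrier_mat n n"
  shows "psd_toeplitz n (complex_of_real a \<cdot>\<^sub>m X + complex_of_real b \<cdot>\<^sub>m X')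
    (complex_of_real a \<cdot>\<^sub>m Y + complex_of_real b \<cdot>\<^sub>m Y')"
  unfolding psd_toeplitz_def
proof (intro ballI)
  fix g h :: "complex vec" assume gh: "g \<in> carrier_vec n" "h \<in> carrier_vec n"
  let ?q = "\<lambda>X Y. Re ((X *\<^sub>v g) \<bullet>c g) + Re ((X *\<^sub>v h) \<bullet>c h) + 2 * Re ((Y *\<^sub>v h) \<bullet>c g)"
  have "0 \<le> a * ?q X Y + b * ?q X' Y'"
    proof (intro add_nonneg_nonneg[of "a * _"] mult_nonneg_nonneg ab)
    show "0 \<le> ?q X Y" "0 \<le> ?q X' Y'"
      using T gh unfolding psd_toeplitz_def by blast+
  qed
  also have "\<dots> = ?q (complex_of_real a \<cdot>\<^sub>m X + complex_of_real b \<cdot>\<^sub>m X')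
      (complex_of_real a \<cdot>\<^sub>m Y + complex_of_real b \<cdot>\<^sub>m Y')"
    using gh c by (simp add: mat_lincomb_form[of _ n] algebra_simps)
  finally show "0 \<le> \<dots>" .
qed

text \<open>The block form of \<open>X\<close> and \<open>c X\<close> at \<open>(g, h)\<close> is the form of \<open>X\<close> at \<open>g + c h\<close>.\<close>

lemma psd_toeplitz_scalar:
  assumes X: "psd_mat n X" and c: "cmod c = 1"
  shows "psd_toeplitz n X (c \<cdot>\<^sub>m X)"
  unfolding psd_toeplitz_def
proof (intro ballI)
  fix g h :: "complex vec" assume g: "g \<in> carrier_vec n" and h: "h \<in> carrier_vec n"
  have Xc: "X \<in> carrier_mat n n" "mat_adjoint X = X"
    using X by (auto simp: psd_mat_def hermitian_mat_def)
  have Xg: "X *\<^sub>v g \<in> carrier_vec n" and Xh: "X *\<^sub>v h \<in> carrier_vec n"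
    using Xc g h by auto
  have sym: "(X *\<^sub>v g) \<bullet>c h = cnj ((X *\<^sub>v h) \<bullet>c g)"
    using cscalar_mult_mat_vec[OF Xc(1) g h] cscalar_swap[OF Xh g] Xc by simp
  have cc: "c * cnj c = 1"
    using complex_norm_square[of c] c by simp
  have cX: "((c \<cdot>\<^sub>m X) *\<^sub>v h) \<bullet>c g = c * ((X *\<^sub>v h) \<bullet>c g)"
  proof -
    have "(c \<cdot>\<^sub>m X) *\<^sub>v h = c \<cdot>\<^sub>v (X *\<^sub>v h)"
      using Xc h by (intro eq_vecI) auto
    then show ?thesis
      using Xh g by (simp add: cscalar_linear[of _ n])
  qed
  let ?w = "g + c \<cdot>\<^sub>v h"
  have w: "?w \<in> carrier_vec n" using g h by simp
  have "X *\<^sub>v ?w = X *\<^sub>v g + c \<cdot>\<^sub>v (X *\<^sub>v h)"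
    using Xc g h by (simp add: mult_add_distrib_mat_vec[of _ n n] mult_mat_vec[of _ n n])
  then have "(X *\<^sub>v ?w) \<bullet>c ?w = (X *\<^sub>v g) \<bullet>c g + c * cnj c * ((X *\<^sub>v h) \<bullet>c h)
      + (c * ((X *\<^sub>v h) \<bullet>c g) + cnj (c * ((X *\<^sub>v h) \<bullet>c g)))"
    using g h Xg Xh by (simp add: cscalar_linear[of _ n] sym algebra_simps)
  moreover have "0 \<le> Re ((X *\<^sub>v ?w) \<bullet>c ?w)"
    using X w by (simp add: psd_mat_iff)
  ultimately show "0 \<le> Re ((X *\<^sub>v g) \<bullet>c g) + Re ((X *\<^sub>v h) \<bullet>c h) + 2 * Re (((c \<cdot>\<^sub>m X) *\<^sub>v h) \<bullet>c g)"
    unfolding cX cc by simp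
qed

text \<open>Contractivity, tested on the pair of singular vectors \<open>(- U e\<^sub>i, V e\<^sub>i)\<close>, where the form
  equals \<open>2 - 2 d\<^sub>i\<close>.\<close>

lemma psd_toeplitz_one_singular_values:
  assumes U: "unitary_mat n U" and V: "unitary_mat n V"
    and T: "psd_toeplitz n (1\<^sub>m n) (U * mat_diag n (\<lambda>i. complex_of_real (d i)) * mat_adjoint V)"
    and i: "i < n"
  shows "d i \<le> 1"
proof -
  note [simp] = unitary_matD(1)[OF U] unitary_matD(1)[OF V]
  let ?e = "unit_vec n i :: complex vec"
  let ?g = "U *\<^sub>v (- 1 \<cdot>\<^sub>v ?e)" and ?h = "V *\<^sub>v ?e"
  let ?C = "U * mat_diag n (\<lambda>i. complex_of_real (d i)) * mat_adjoint V"
  have g: "?g \<in> carrier_vec n" and h: "?h \<in> carrier_vec n"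
    by (auto intro!: square_mult_vec_carrier)
  have iso: "(W *\<^sub>v x) \<bullet>c (W *\<^sub>v x) = x \<bullet>c x" if W: "unitary_mat n W" and x: "x \<in> carrier_vec n" for W x
    using cscalar_mult_mat_vec[of W n n x "W *\<^sub>v x"] unitary_matD(1)[OF W]
      unitary_mult_vec_cancel(1)[OF W x] x by simp
  have ee: "?e \<bullet>c ?e = 1"
    using i by (simp add: cscalar_sum[of _ n] unit_vec_def if_distrib[of "\<lambda>x. x * _"] cong: if_cong)
  have gg: "?g \<bullet>c ?g = 1" and hh: "?h \<bullet>c ?h = 1"
    using iso[OF U, of "- 1 \<cdot>\<^sub>v ?e"] iso[OF V, of ?e] ee by (simp_all add: cscalar_linear[of _ n])
  have "(?C *\<^sub>v ?h) \<bullet>c ?g = (\<Sum>k<n. complex_of_real (d k) * ?e $ k * cnj ((- 1 \<cdot>\<^sub>v ?e) $ k))"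
    by (subst unitary_diag_form[of _ n])
       (simp_all add: unitary_mult_vec_cancel[OF U] unitary_mult_vec_cancel[OF V])
  also have "\<dots> = (\<Sum>k<n. if k = i then - complex_of_real (d k) else 0)"
    using i by (intro sum.cong) (auto simp: unit_vec_def)
  also have "\<dots> = - complex_of_real (d i)"
    using i by simp
  finally have "(?C *\<^sub>v ?h) \<bullet>c ?g = - complex_of_real (d i)" .
  moreover have "0 \<le> Re ((1\<^sub>m n *\<^sub>v ?g) \<bullet>c ?g) + Re ((1\<^sub>m n *\<^sub>v ?h) \<bullet>c ?h) + 2 * Re ((?C *\<^sub>v ?h) \<bullet>c ?g)"
    using T g h unfolding psd_toeplitz_def by blast
  ultimately show ?thesis
    using gg hh g h by simp
qed

section \<open>Separability of positive block Toeplitz matrices\<close>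

text \<open>The shift by \<open>e\<close> makes the factor invertible, so that congruence by its inverse \<open>R\<close> can
  normalize the diagonal blocks to the identity.\<close>

lemma psd_shift_factorization:
  assumes J: "psd_mat n J" and e: "e > 0"
  shows "\<exists>S R. S \<in> carrier_mat n n \<and> R \<in> carrier_mat n n \<and> S * R = 1\<^sub>m n \<and> R * S = 1\<^sub>m n \<and>
    mat_adjoint S * S = J + complex_of_real e \<cdot>\<^sub>m 1\<^sub>m n"
proof -
  obtain V d where V: "unitary_mat n V" and d: "\<forall>i<n. 0 \<le> d i"
    and Jeq: "J = V * mat_diag n (\<lambda>i. complex_of_real (d i)) * mat_adjoint V"
    using psd_unitarily_diagonalizable[OF J] by blast
  note [simp] = unitary_matD[OF V]
  define s where "s i = complex_of_real (sqrt (d i + e))" for i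
  have s0: "s i \<noteq> 0" and ss: "cnj (s i) * s i = complex_of_real (d i) + complex_of_real e * 1"
    if "i < n" for i
    using d[rule_format, OF that] e by (auto simp: s_def simp flip: of_real_mult of_real_add)
  have s1: "mat_diag n (\<lambda>i. s i * (1 / s i)) = 1\<^sub>m n" "mat_diag n (\<lambda>i. (1 / s i) * s i) = 1\<^sub>m n"
    using s0 by (auto simp: mat_diag_def intro!: eq_matI)
  have s2: "mat_diag n (\<lambda>i. cnj (s i) * s i)
      = mat_diag n (\<lambda>i. complex_of_real (d i)) + complex_of_real e \<cdot>\<^sub>m 1\<^sub>m n"
    using ss by (auto simp: mat_diag_def intro!: eq_matI)
  let ?S = "mat_diag n s * mat_adjoint V" and ?R = "V * mat_diag n (\<lambda>i. 1 / s i)"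
  have "?S * ?R = 1\<^sub>m n"
    using s1 unitary_mult_cancel[OF V] by (simp add: square_mult_assoc[of _ n])
  moreover have "?R * ?S = 1\<^sub>m n"
    using s1 by (simp add: square_mult_assoc[of _ n] diag_mult_diag_mult)
  moreover have "mat_adjoint ?S * ?S = V * (mat_diag n (\<lambda>i. cnj (s i) * s i) * mat_adjoint V)"
    by (simp add: mat_adjoint_mult[of _ n n _ n] square_mult_assoc[of _ n] diag_mult_diag_mult)
  moreover have "\<dots> = J + complex_of_real e \<cdot>\<^sub>m 1\<^sub>m n"
    unfolding s2 Jeq by (simp add: add_mult_distrib_mat[of _ n n _ _ n] mult_add_distrib_mat[of _ n n _ n]
      mult_smult_assoc_mat[of _ n n _ n] mult_smult_distrib[of _ n n _ n] square_mult_assoc[of _ n])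
  ultimately show ?thesis
    by (intro exI[of _ ?S] exI[of _ ?R]) simp
qed

text \<open>In terms of the columns \<open>a\<^sub>k\<close> of \<open>A\<close>, the conclusion says \<open>S\<^sup>* S = \<Sum>\<^sub>k a\<^sub>k a\<^sub>k\<^sup>*\<close> and
  \<open>S\<^sup>* W S = \<Sum>\<^sub>k f\<^sub>k a\<^sub>k a\<^sub>k\<^sup>*\<close>. It follows from diagonalizing \<open>W\<close>.\<close>

lemma unitary_congruence_diagonal:
  assumes W: "unitary_mat n W" and S: "S \<in> carrier_mat n n"
  shows "\<exists>A f. A \<in> carrier_mat n n \<and> (\<forall>i<n. cmod (f i) = 1) \<and> A * mat_adjoint A = mat_adjoint S * S \<and>
    mat_adjoint S * W * S = A * mat_diag n f * mat_adjoint A"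
proof -
  note [simp] = unitary_matD[OF W] S
  obtain Q f where Q: "unitary_mat n Q" and Weq: "W = Q * mat_diag n f * mat_adjoint Q"
    using normal_unitarily_diagonalizable[of W n] by auto
  note [simp] = unitary_matD[OF Q]
  have "mat_adjoint Q * W * Q = mat_diag n f"
    unfolding Weq using unitary_mult_cancel[OF Q] by (simp add: square_mult_assoc[of _ n])
  then have "unitary_mat n (mat_diag n f)"
    using unitary_mat_mult[OF unitary_mat_mult[OF unitary_mat_adjoint[OF Q] W] Q] by simp
  then have D: "mat_diag n (\<lambda>i. cnj (f i) * f i) = (1\<^sub>m n :: complex mat)"
    by (auto simp: unitary_mat_def)
  have f: "cmod (f i) = 1" if "i < n" for i
  proof -
    have "cnj (f i) * f i = 1"
      using arg_cong[OF D, of "\<lambda>M. M $$ (i,i)"] that by (simp add: mat_diag_def)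
    then have "complex_of_real ((cmod (f i))\<^sup>2) = 1"
      using complex_norm_square[of "f i"] by (simp add: mult.commute)
    then have "(cmod (f i))\<^sup>2 = 1"
      by (simp only: of_real_eq_1_iff)
    then show ?thesis
      by (simp add: power2_eq_1_iff) (use norm_ge_zero[of "f i"] in linarith)
  qed
  let ?A = "mat_adjoint S * Q"
  have "?A * mat_adjoint ?A = mat_adjoint S * S"
    using unitary_mult_cancel[OF Q]
    by (simp add: mat_adjoint_mult[of _ n n _ n] square_mult_assoc[of _ n])
  moreover have "mat_adjoint S * W * S = ?A * mat_diag n f * mat_adjoint ?A"
    unfolding Weq by (simp add: mat_adjoint_mult[of _ n n _ n] square_mult_assoc[of _ n])
  moreover have "?A \<in> carrier_mat n n"
    by (intro square_mult_carrier mat_adjoint_carrier) simp_all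
  ultimately show ?thesis
    using f by blast
qed

text \<open>Separability: the block matrix of \<open>J + e\<close> and \<open>Z\<close> is a mean of two sums of tensor products of the
  rank one matrices \<open>a\<^sub>k a\<^sub>k\<^sup>*\<close> with positive semidefinite 2 by 2 Toeplitz matrices of scalars.\<close>

theorem psd_toeplitz_separable:
  assumes J: "psd_mat n J" and Z: "Z \<in> carrier_mat n n" and T: "psd_toeplitz n J Z" and e: "e > 0"
  shows "\<exists>A B f g. A \<in> carrier_mat n n \<and> B \<in> carrier_mat n n \<and>
    (\<forall>i<n. cmod (f i) = 1) \<and> (\<forall>i<n. cmod (g i) = 1) \<and>
    A * mat_adjoint A = J + complex_of_real e \<cdot>\<^sub>m 1\<^sub>m n \<and>
    B * mat_adjoint B = J + complex_of_real e \<cdot>\<^sub>m 1\<^sub>m n \<and>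
    Z = (1/2) \<cdot>\<^sub>m (A * mat_diag n f * mat_adjoint A) + (1/2) \<cdot>\<^sub>m (B * mat_diag n g * mat_adjoint B)"
proof -
  have Jc: "J \<in> carrier_mat n n"
    using J by (auto simp: psd_mat_def hermitian_mat_def)
  obtain S R where S: "S \<in> carrier_mat n n" and R: "R \<in> carrier_mat n n"
    and SR: "S * R = 1\<^sub>m n" and RS: "R * S = 1\<^sub>m n"
    and SS: "mat_adjoint S * S = J + complex_of_real e \<cdot>\<^sub>m 1\<^sub>m n"
    using psd_shift_factorization[OF J e] by blast
  note [simp] = Jc Z S R
  \<comment> \<open>the contraction with \<open>Z = S\<^sup>* C S\<close>\<close>
  let ?C = "mat_adjoint R * Z * R"
  have "psd_toeplitz n (1\<^sub>m n) (0\<^sub>m n n)"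
    by (auto simp: psd_toeplitz_def cscalar_self_nonneg intro!: add_nonneg_nonneg)
  then have "psd_toeplitz n (complex_of_real 1 \<cdot>\<^sub>m J + complex_of_real e \<cdot>\<^sub>m 1\<^sub>m n)
      (complex_of_real 1 \<cdot>\<^sub>m Z + complex_of_real e \<cdot>\<^sub>m 0\<^sub>m n n)"
    using T e by (intro psd_toeplitz_lincomb) auto
  moreover have "complex_of_real 1 \<cdot>\<^sub>m J = J" "complex_of_real 1 \<cdot>\<^sub>m Z + complex_of_real e \<cdot>\<^sub>m 0\<^sub>m n n = Z"
    using carrier_matD[OF Jc] carrier_matD[OF Z] by (auto intro!: eq_matI)
  ultimately have "psd_toeplitz n (mat_adjoint S * S) Z"
    by (simp add: SS)
  then have T1: "psd_toeplitz n (mat_adjoint R * (mat_adjoint S * S) * R) ?C"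
    by (rule psd_toeplitz_congruence) auto
  have RS': "mat_adjoint R * mat_adjoint S = 1\<^sub>m n"
    unfolding mat_adjoint_mult[OF S R, symmetric] SR by (rule mat_adjoint_one)
  have SR': "mat_adjoint S * mat_adjoint R = 1\<^sub>m n"
    unfolding mat_adjoint_mult[OF R S, symmetric] RS by (rule mat_adjoint_one)
  have cancel: "mat_adjoint R * (mat_adjoint S * M) = M" "mat_adjoint S * (mat_adjoint R * M) = M"
    if "M \<in> carrier_mat n n" for M
    using that RS' SR' square_mult_assoc[of "mat_adjoint R" n "mat_adjoint S" M]
      square_mult_assoc[of "mat_adjoint S" n "mat_adjoint R" M] by simp_all
  have "mat_adjoint R * (mat_adjoint S * S) * R = 1\<^sub>m n"
    using SR cancel by (simp add: square_mult_assoc[of _ n])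
  with T1 have T1: "psd_toeplitz n (1\<^sub>m n) ?C" by simp
  have "?C \<in> carrier_mat n n"
    by simp
  then obtain U V d where U: "unitary_mat n U" and V: "unitary_mat n V" and d: "\<forall>i<n. 0 \<le> d i"
    and Ceq: "?C = U * mat_diag n (\<lambda>i. complex_of_real (d i)) * mat_adjoint V"
    using singular_value_decomposition by blast
  note [simp] = unitary_matD[OF U] unitary_matD[OF V]
  have d1: "d i \<le> 1" if "i < n" for i
    using psd_toeplitz_one_singular_values[OF U V _ that] T1 Ceq by simp
  \<comment> \<open>a singular value \<open>d\<close> in \<open>[0,1]\<close> is the real part of the unimodular number \<open>d + \<i> sqrt (1 - d\<^sup>2)\<close>\<close>
  define c where "c i = Complex (d i) (sqrt (1 - (d i)\<^sup>2))" for i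
  have c1: "cmod (c i) = 1" if "i < n" for i
  proof -
    have "(d i)\<^sup>2 \<le> 1"
      using d d1 that by (simp add: power_le_one)
    then show ?thesis by (simp add: c_def cmod_def)
  qed
  have cd: "complex_of_real (d i) = (1/2) * c i + (1/2) * cnj (c i)" for i
    by (simp add: c_def complex_eq_iff)
  let ?W = "U * mat_diag n c * mat_adjoint V" and ?W' = "U * mat_diag n (\<lambda>i. cnj (c i)) * mat_adjoint V"
  have W: "unitary_mat n ?W" "unitary_mat n ?W'"
    using c1 by (auto intro!: unitary_mat_mult unitary_mat_diag unitary_mat_adjoint U V)
  have "Z = mat_adjoint S * ?C * S"
    using cancel RS by (simp add: square_mult_assoc[of _ n])
  also have "\<dots> = (mat_adjoint S * U) * mat_diag n (\<lambda>i. complex_of_real (d i)) * (mat_adjoint V * S)"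
    unfolding Ceq by (simp add: square_mult_assoc[of _ n])
  also have "\<dots> = (1/2) \<cdot>\<^sub>m ((mat_adjoint S * U) * mat_diag n c * (mat_adjoint V * S))
      + (1/2) \<cdot>\<^sub>m ((mat_adjoint S * U) * mat_diag n (\<lambda>i. cnj (c i)) * (mat_adjoint V * S))"
    unfolding cd by (intro diag_sandwich_linear) (auto intro!: square_mult_carrier)
  also have "\<dots> = (1/2) \<cdot>\<^sub>m (mat_adjoint S * ?W * S) + (1/2) \<cdot>\<^sub>m (mat_adjoint S * ?W' * S)"
    by (simp add: square_mult_assoc[of _ n])
  finally have Zeq: "Z = (1/2) \<cdot>\<^sub>m (mat_adjoint S * ?W * S) + (1/2) \<cdot>\<^sub>m (mat_adjoint S * ?W' * S)" .
  obtain A f where A: "A \<in> carrier_mat n n" "\<forall>i<n. cmod (f i) = 1" "A * mat_adjoint A = mat_adjoint S * S"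
    "mat_adjoint S * ?W * S = A * mat_diag n f * mat_adjoint A"
    using unitary_congruence_diagonal[OF W(1) S] by blast
  obtain B g where B: "B \<in> carrier_mat n n" "\<forall>i<n. cmod (g i) = 1" "B * mat_adjoint B = mat_adjoint S * S"
    "mat_adjoint S * ?W' * S = B * mat_diag n g * mat_adjoint B"
    using unitary_congruence_diagonal[OF W(2) S] by blast
  show ?thesis
    using A(1,2) B(1,2) A(3)[unfolded SS] B(3)[unfolded SS] Zeq[unfolded A(4) B(4)] by blast
qed

section \<open>Positive linear maps\<close>

lemma positive_linear_mapD:
  assumes "positive_linear_map n m \<Phi>"
  shows "A \<in> carrier_mat n n \<Longrightarrow> \<Phi> A \<in> carrier_mat m m"
    and "A \<in> carrier_mat n n \<Longrightarrow> B \<in> carrier_mat n n \<Longrightarrow>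
      \<Phi> (a \<cdot>\<^sub>m A + b \<cdot>\<^sub>m B) = a \<cdot>\<^sub>m \<Phi> A + b \<cdot>\<^sub>m \<Phi> B"
    and "psd_mat n A \<Longrightarrow> psd_mat m (\<Phi> A)"
proof -
  have "linear_map class_ring (module_mat TYPE(complex) n n) (module_mat TYPE(complex) m m) \<Phi>"
    using assms by (simp add: positive_linear_map_def)
  then have hom: "\<Phi> \<in> LinearCombinations.module_hom class_ring (module_mat TYPE(complex) n n) (module_mat TYPE(complex) m m)"
    unfolding linear_map_def mod_hom_def mod_hom_axioms_def by blast
  have add: "\<Phi> (X + Y) = \<Phi> X + \<Phi> Y" if "X \<in> carrier_mat n n" "Y \<in> carrier_mat n n" for X Y
    using LinearCombinations.module_hom_add[OF hom] that by (simp add: module_mat_simps)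
  have smult: "\<Phi> (c \<cdot>\<^sub>m X) = c \<cdot>\<^sub>m \<Phi> X" if "X \<in> carrier_mat n n" for c X
    using LinearCombinations.module_hom_smult[OF hom] that by (simp add: module_mat_simps class_ring_simps)
  show "A \<in> carrier_mat n n \<Longrightarrow> \<Phi> A \<in> carrier_mat m m"
    using LinearCombinations.module_hom_closed[OF hom] by (auto simp: module_mat_simps)
  show "A \<in> carrier_mat n n \<Longrightarrow> B \<in> carrier_mat n n \<Longrightarrow>
      \<Phi> (a \<cdot>\<^sub>m A + b \<cdot>\<^sub>m B) = a \<cdot>\<^sub>m \<Phi> A + b \<cdot>\<^sub>m \<Phi> B"
    by (simp add: add smult)
  show "psd_mat n A \<Longrightarrow> psd_mat m (\<Phi> A)"
    using assms by (simp add: positive_linear_map_def)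
qed

text \<open>The columns of \<open>A\<close> are added one at a time: passing from \<open>k\<close> to \<open>k + 1\<close> adds \<open>\<Phi>\<close> of a rank one
  positive semidefinite matrix \<open>E\<close> to the diagonal block and \<open>f\<^sub>k\<close> times the same matrix to the
  off-diagonal block.\<close>

lemma positive_map_separable_toeplitz:
  assumes Phi: "positive_linear_map n m \<Phi>" and A: "A \<in> carrier_mat n n"
    and f: "\<And>i. i < n \<Longrightarrow> cmod (f i) = 1"
  shows "psd_toeplitz m (\<Phi> (A * mat_adjoint A)) (\<Phi> (A * mat_diag n f * mat_adjoint A))"
proof -
  note Phi' = positive_linear_mapD[OF Phi]
  note [simp] = A
  let ?M = "\<lambda>f. A * mat_diag n f * mat_adjoint A"
  have M: "?M f \<in> carrier_mat n n" for f
    by simp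
  have "k \<le> n \<Longrightarrow> psd_toeplitz m (\<Phi> (?M (\<lambda>i. if i < k then 1 else 0))) (\<Phi> (?M (\<lambda>i. if i < k then f i else 0)))"
    for k
  proof (induction k)
    case 0
    have "\<Phi> (?M (\<lambda>i. 0)) = \<Phi> (0 \<cdot>\<^sub>m ?M (\<lambda>i. 0) + 0 \<cdot>\<^sub>m ?M (\<lambda>i. 0))"
      using diag_sandwich_linear[of A n "mat_adjoint A" 0 "\<lambda>i. 0" 0 "\<lambda>i. 0"] by simp
    also have "\<dots> = 0 \<cdot>\<^sub>m \<Phi> (?M (\<lambda>i. 0)) + 0 \<cdot>\<^sub>m \<Phi> (?M (\<lambda>i. 0))"
      by (rule Phi'(2)[OF M M])
    also have "\<dots> = 0\<^sub>m m m"
      using carrier_matD[OF Phi'(1)[OF M]] by (intro eq_matI) auto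
    finally have "\<Phi> (?M (\<lambda>i. 0)) = 0\<^sub>m m m" .
    moreover have "psd_toeplitz m (0\<^sub>m m m) (0\<^sub>m m m)"
      by (auto simp: psd_toeplitz_def)
    ultimately show ?case by simp
  next
    case (Suc k)
    let ?E = "?M (\<lambda>i. if i = k then 1 else 0)"
    have "psd_mat n ?E"
    proof -
      have "psd_mat n (?M (\<lambda>i. complex_of_real (if i = k then 1 else 0)))"
        by (rule diag_conjugate_psd[OF A]) simp
      moreover have "(\<lambda>i. complex_of_real (if i = k then 1 else 0)) = (\<lambda>i. if i = k then 1 else 0)"
        by auto
      ultimately show ?thesis
        by (simp only:)
    qed
    then have E: "psd_toeplitz m (\<Phi> ?E) (f k \<cdot>\<^sub>m \<Phi> ?E)"
      using Phi'(3) f Suc.prems by (intro psd_toeplitz_scalar) auto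
    have "(\<lambda>i. if i < Suc k then 1 else 0) = (\<lambda>i. 1 * (if i < k then 1 else 0) + 1 * (if i = k then 1 else 0 :: complex))"
      by (auto simp: less_Suc_eq)
    then have 1: "\<Phi> (?M (\<lambda>i. if i < Suc k then 1 else 0)) = 1 \<cdot>\<^sub>m \<Phi> (?M (\<lambda>i. if i < k then 1 else 0)) + 1 \<cdot>\<^sub>m \<Phi> ?E"
      using diag_sandwich_linear[of A n "mat_adjoint A" 1 "\<lambda>i. if i < k then 1 else 0" 1 "\<lambda>i. if i = k then 1 else 0"]
        Phi'(2)[OF M M, of 1 _ 1] by simp
    have "(\<lambda>i. if i < Suc k then f i else 0) = (\<lambda>i. 1 * (if i < k then f i else 0) + f k * (if i = k then 1 else 0))"
      by (auto simp: less_Suc_eq)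
    then have "\<Phi> (?M (\<lambda>i. if i < Suc k then f i else 0)) = 1 \<cdot>\<^sub>m \<Phi> (?M (\<lambda>i. if i < k then f i else 0)) + f k \<cdot>\<^sub>m \<Phi> ?E"
      using diag_sandwich_linear[of A n "mat_adjoint A" 1 "\<lambda>i. if i < k then f i else 0" "f k" "\<lambda>i. if i = k then 1 else 0"]
        Phi'(2)[OF M M, of 1 _ "f k"] by simp
    also have "\<dots> = 1 \<cdot>\<^sub>m \<Phi> (?M (\<lambda>i. if i < k then f i else 0)) + 1 \<cdot>\<^sub>m (f k \<cdot>\<^sub>m \<Phi> ?E)"
      by (intro eq_matI) auto
    finally have 2: "\<Phi> (?M (\<lambda>i. if i < Suc k then f i else 0)) = \<dots>" .
    show ?case
      unfolding 1 2 using psd_toeplitz_lincomb[OF Suc.IH E, of 1 1] Suc.prems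
      by (simp add: Phi'(1)[OF M])
  qed
  from this[of n] have "psd_toeplitz m (\<Phi> (?M (\<lambda>i. if i < n then 1 else 0))) (\<Phi> (?M (\<lambda>i. if i < n then f i else 0)))"
    by simp
  moreover have "mat_diag n (\<lambda>i. if i < n then f i else 0) = mat_diag n f"
    "mat_diag n (\<lambda>i. if i < n then 1 else 0) = (1\<^sub>m n :: complex mat)"
    by (auto simp: mat_diag_def intro!: eq_matI)
  ultimately show ?thesis
    by simp
qed

lemma nonneg_of_all_perturbations:
  fixes x y :: real
  assumes "\<And>e. e > 0 \<Longrightarrow> 0 \<le> x + e * y"
  shows "0 \<le> x"
proof (rule ccontr)
  assume "\<not> 0 \<le> x"
  then have x: "x < 0" by simp
  define e where "e = - x / (2 * (\<bar>y\<bar> + 1))"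
  have e: "e > 0"
    using x by (simp add: e_def divide_neg_pos)
  have "e * y \<le> e * (\<bar>y\<bar> + 1)"
    using e by (intro mult_left_mono) auto
  also have "\<dots> = - x / 2"
    by (simp add: e_def field_simps)
  finally show False
    using assms[OF e] x by linarith
qed

text \<open>Positive maps act on positive block Toeplitz matrices as if they were 2-positive. Separability
  gives the conclusion with \<open>J + e\<close> in place of \<open>J\<close>; for fixed \<open>g\<close> and \<open>h\<close> the form is affine
  in \<open>e\<close>, so \<open>e\<close> may tend to \<open>0\<close>.\<close>

theorem positive_map_psd_toeplitz:
  assumes Phi: "positive_linear_map n m \<Phi>" and J: "psd_mat n J" and Z: "Z \<in> carrier_mat n n"
    and T: "psd_toeplitz n J Z"
  shows "psd_toeplitz m (\<Phi> J) (\<Phi> Z)"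
  unfolding psd_toeplitz_def
proof (intro ballI)
  note Phi' = positive_linear_mapD[OF Phi]
  have Jc: "J \<in> carrier_mat n n"
    using J by (auto simp: psd_mat_def hermitian_mat_def)
  fix g h :: "complex vec" assume g: "g \<in> carrier_vec m" and h: "h \<in> carrier_vec m"
  let ?x = "Re ((\<Phi> J *\<^sub>v g) \<bullet>c g) + Re ((\<Phi> J *\<^sub>v h) \<bullet>c h) + 2 * Re ((\<Phi> Z *\<^sub>v h) \<bullet>c g)"
  let ?y = "Re ((\<Phi> (1\<^sub>m n) *\<^sub>v g) \<bullet>c g) + Re ((\<Phi> (1\<^sub>m n) *\<^sub>v h) \<bullet>c h)"
  have pos: "0 \<le> ?x + e * ?y" if e: "e > 0" for e
  proof -
    let ?K = "J + complex_of_real e \<cdot>\<^sub>m 1\<^sub>m n"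
    obtain A B f1 f2 where A: "A \<in> carrier_mat n n" and B: "B \<in> carrier_mat n n"
      and f1: "\<And>i. i < n \<Longrightarrow> cmod (f1 i) = 1" and f2: "\<And>i. i < n \<Longrightarrow> cmod (f2 i) = 1"
      and AA: "A * mat_adjoint A = ?K" and BB: "B * mat_adjoint B = ?K"
      and Zeq: "Z = (1/2) \<cdot>\<^sub>m (A * mat_diag n f1 * mat_adjoint A) + (1/2) \<cdot>\<^sub>m (B * mat_diag n f2 * mat_adjoint B)"
      using psd_toeplitz_separable[OF J Z T e] by blast
    let ?M = "A * mat_diag n f1 * mat_adjoint A" and ?N = "B * mat_diag n f2 * mat_adjoint B"
    have c: "\<Phi> ?K \<in> carrier_mat m m" "\<Phi> ?M \<in> carrier_mat m m" "\<Phi> ?N \<in> carrier_mat m m"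
      using Jc A B by (auto intro!: Phi'(1))
    have PZ: "\<Phi> Z = (1/2) \<cdot>\<^sub>m \<Phi> ?M + (1/2) \<cdot>\<^sub>m \<Phi> ?N"
      unfolding Zeq using A B by (intro Phi'(2)) auto
    have K: "?K = 1 \<cdot>\<^sub>m J + complex_of_real e \<cdot>\<^sub>m 1\<^sub>m n"
      using carrier_matD[OF Jc] by (intro eq_matI) auto
    have PK: "\<Phi> ?K = 1 \<cdot>\<^sub>m \<Phi> J + complex_of_real e \<cdot>\<^sub>m \<Phi> (1\<^sub>m n)"
      by (subst K, rule Phi'(2)[OF Jc one_carrier_mat])
    have "psd_toeplitz m (\<Phi> ?K) (\<Phi> ?M)" "psd_toeplitz m (\<Phi> ?K) (\<Phi> ?N)"
      using positive_map_separable_toeplitz[OF Phi A f1] positive_map_separable_toeplitz[OF Phi B f2]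
      by (simp_all add: AA BB)
    then have 1: "0 \<le> Re ((\<Phi> ?K *\<^sub>v g) \<bullet>c g) + Re ((\<Phi> ?K *\<^sub>v h) \<bullet>c h) + 2 * Re ((\<Phi> ?M *\<^sub>v h) \<bullet>c g)"
      and 2: "0 \<le> Re ((\<Phi> ?K *\<^sub>v g) \<bullet>c g) + Re ((\<Phi> ?K *\<^sub>v h) \<bullet>c h) + 2 * Re ((\<Phi> ?N *\<^sub>v h) \<bullet>c g)"
      using g h unfolding psd_toeplitz_def by blast+
    have 3: "(\<Phi> Z *\<^sub>v h) \<bullet>c g = (1/2) * ((\<Phi> ?M *\<^sub>v h) \<bullet>c g) + (1/2) * ((\<Phi> ?N *\<^sub>v h) \<bullet>c g)"
      unfolding PZ using c g h by (intro mat_lincomb_form)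
    have 4: "(\<Phi> ?K *\<^sub>v v) \<bullet>c v = 1 * ((\<Phi> J *\<^sub>v v) \<bullet>c v) + complex_of_real e * ((\<Phi> (1\<^sub>m n) *\<^sub>v v) \<bullet>c v)"
      if "v \<in> carrier_vec m" for v
      unfolding PK by (rule mat_lincomb_form[OF Phi'(1)[OF Jc] Phi'(1)[OF one_carrier_mat] that that])
    have 5: "Re ((\<Phi> Z *\<^sub>v h) \<bullet>c g) = (Re ((\<Phi> ?M *\<^sub>v h) \<bullet>c g) + Re ((\<Phi> ?N *\<^sub>v h) \<bullet>c g)) / 2"
      by (simp only: 3) simp
    have 6: "Re ((\<Phi> ?K *\<^sub>v v) \<bullet>c v) = Re ((\<Phi> J *\<^sub>v v) \<bullet>c v) + e * Re ((\<Phi> (1\<^sub>m n) *\<^sub>v v) \<bullet>c v)"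
      if "v \<in> carrier_vec m" for v
      by (simp only: 4[OF that]) simp
    have arith: "0 \<le> jg + jh + 2 * z + e * (og + oh)"
      if "0 \<le> kg + kh + 2 * a" "0 \<le> kg + kh + 2 * b" "z = (a + b) / 2"
        "kg = jg + e * og" "kh = jh + e * oh" for jg jh og oh kg kh a b z :: real
      using that by (simp add: field_simps)
    show ?thesis
      by (rule arith[OF 1 2 5 6[OF g] 6[OF h]])
  qed
  show "0 \<le> ?x"
    by (rule nonneg_of_all_perturbations[OF pos])
qed

text \<open>With the unitary polar factor \<open>W\<close> of \<open>Y\<close>, so that \<open>|Y| = W\<^sup>* Y\<close>, the form at \<open>(- W v, v)\<close> is the
  form of \<open>X + W\<^sup>* X W - 2 |Y|\<close> at \<open>v\<close>.\<close>

lemma psd_toeplitz_abs_le: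
  assumes X: "hermitian_mat m X" and Y: "Y \<in> carrier_mat m m" and T: "psd_toeplitz m X Y"
  shows "\<exists>V. unitary_mat m V \<and>
    loewner_le m (mat_abs Y) ((1 / 2 :: complex) \<cdot>\<^sub>m (X + V * X * mat_adjoint V))"
proof -
  have Xc: "X \<in> carrier_mat m m" "mat_adjoint X = X"
    using X by (auto simp: hermitian_mat_def)
  obtain U V d where U: "unitary_mat m U" and V: "unitary_mat m V" and d: "\<forall>i<m. 0 \<le> d i"
    and Yeq: "Y = U * mat_diag m (\<lambda>i. complex_of_real (d i)) * mat_adjoint V"
    using singular_value_decomposition[OF Y] by blast
  define W where "W = U * mat_adjoint V"
  have W: "unitary_mat m W"
    unfolding W_def by (intro unitary_mat_mult unitary_mat_adjoint U V)
  note [simp] = unitary_matD[OF U] unitary_matD[OF V] Xc(1) Y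
  have Wc: "W \<in> carrier_mat m m" and Wa: "mat_adjoint W \<in> carrier_mat m m"
    using unitary_matD(1)[OF W] by simp_all
  have abs: "mat_abs Y = mat_adjoint W * Y"
    unfolding mat_abs_svd[OF U V d Yeq] unfolding Yeq W_def using unitary_mult_cancel[OF U]
    by (simp add: mat_adjoint_mult[of _ m m _ m] square_mult_assoc[of _ m])
  have absH: "hermitian_mat m (mat_abs Y)"
    using diag_conjugate_psd[OF unitary_matD(1)[OF V] d] unfolding mat_abs_svd[OF U V d Yeq]
    by (simp add: psd_mat_def)
  let ?M = "(1 / 2 :: complex) \<cdot>\<^sub>m (X + mat_adjoint W * X * W)"
  have c: "mat_adjoint W * X * W \<in> carrier_mat m m"
    using Wc by simp
  have "mat_adjoint (mat_adjoint W * X * W) = mat_adjoint W * X * W"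
    using Wc Xc by (simp add: mat_adjoint_mult[of _ m m _ m] square_mult_assoc[of _ m])
  then have MH: "hermitian_mat m ?M"
    using c Xc by (simp add: hermitian_mat_def mat_adjoint_smult mat_adjoint_add[of _ m m])
  have ac: "mat_abs Y \<in> carrier_mat m m" "mat_adjoint (mat_abs Y) = mat_abs Y"
    and Mc: "?M \<in> carrier_mat m m" "mat_adjoint ?M = ?M"
    using absH MH by (auto simp: hermitian_mat_def)
  have DH: "hermitian_mat m (?M - mat_abs Y)"
    using mat_adjoint_minus[OF Mc(1) ac(1)] minus_carrier_mat[OF ac(1)] ac Mc
    unfolding hermitian_mat_def by simp
  have "0 \<le> Re (((?M - mat_abs Y) *\<^sub>v v) \<bullet>c v)" if v: "v \<in> carrier_vec m" for v
  proof -
    have Wv: "W *\<^sub>v v \<in> carrier_vec m"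
      using Wc v by simp
    have D: "?M - mat_abs Y = 1 \<cdot>\<^sub>m ?M + (-1) \<cdot>\<^sub>m mat_abs Y"
      using carrier_matD[OF Mc(1)] carrier_matD[OF ac(1)] by (intro eq_matI) auto
    have 1: "((?M - mat_abs Y) *\<^sub>v v) \<bullet>c v = 1 * ((?M *\<^sub>v v) \<bullet>c v) + (-1) * ((mat_abs Y *\<^sub>v v) \<bullet>c v)"
      by (subst D, rule mat_lincomb_form[OF Mc(1) ac(1) v v])
    have E: "?M = (1/2) \<cdot>\<^sub>m X + (1/2) \<cdot>\<^sub>m (mat_adjoint W * X * W)"
      using c by (intro add_smult_distrib_left_mat) auto
    have 2: "(?M *\<^sub>v v) \<bullet>c v = (1/2) * ((X *\<^sub>v v) \<bullet>c v) + (1/2) * (((mat_adjoint W * X * W) *\<^sub>v v) \<bullet>c v)"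
      by (subst E, rule mat_lincomb_form[OF Xc(1) c v v])
    have "(mat_adjoint W * X * W) *\<^sub>v v = mat_adjoint W *\<^sub>v (X *\<^sub>v (W *\<^sub>v v))"
      using Wc v by (simp add: assoc_mult_mat_vec[of _ m m _ m])
    then have 3: "((mat_adjoint W * X * W) *\<^sub>v v) \<bullet>c v = (X *\<^sub>v (W *\<^sub>v v)) \<bullet>c (W *\<^sub>v v)"
      using cscalar_mult_mat_vec[OF Wa, of "X *\<^sub>v (W *\<^sub>v v)" v] Wv v by simp
    have "mat_abs Y *\<^sub>v v = mat_adjoint W *\<^sub>v (Y *\<^sub>v v)"
      unfolding abs using Wa v by (simp add: assoc_mult_mat_vec[of _ m m _ m])
    then have 4: "(mat_abs Y *\<^sub>v v) \<bullet>c v = (Y *\<^sub>v v) \<bullet>c (W *\<^sub>v v)"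
      using cscalar_mult_mat_vec[OF Wa, of "Y *\<^sub>v v" v] v by simp
    let ?g = "(-1) \<cdot>\<^sub>v (W *\<^sub>v v)"
    have g: "?g \<in> carrier_vec m"
      using Wv by simp
    have "0 \<le> Re ((X *\<^sub>v ?g) \<bullet>c ?g) + Re ((X *\<^sub>v v) \<bullet>c v) + 2 * Re ((Y *\<^sub>v v) \<bullet>c ?g)"
      using T g v unfolding psd_toeplitz_def by blast
    moreover have "X *\<^sub>v ?g = (-1) \<cdot>\<^sub>v (X *\<^sub>v (W *\<^sub>v v))"
      by (rule mult_mat_vec[OF Xc(1) Wv])
    then have "(X *\<^sub>v ?g) \<bullet>c ?g = (X *\<^sub>v (W *\<^sub>v v)) \<bullet>c (W *\<^sub>v v)"
      using square_mult_vec_carrier[OF Xc(1) Wv] Wv by (simp only: cscalar_linear[of _ m] smult_carrier_vec) simp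
    moreover have "(Y *\<^sub>v v) \<bullet>c ?g = cnj (-1) * ((Y *\<^sub>v v) \<bullet>c (W *\<^sub>v v))"
      by (rule cscalar_smult_right[OF square_mult_vec_carrier[OF Y v] Wv])
    ultimately have "0 \<le> Re ((X *\<^sub>v (W *\<^sub>v v)) \<bullet>c (W *\<^sub>v v)) + Re ((X *\<^sub>v v) \<bullet>c v)
        + 2 * Re (cnj (-1) * ((Y *\<^sub>v v) \<bullet>c (W *\<^sub>v v)))"
      by (simp only:)
    then show ?thesis
      unfolding 1 2 3 4 by simp
  qed
  with absH MH DH have "loewner_le m (mat_abs Y) ?M"
    unfolding loewner_le_def psd_mat_iff by blast
  then show ?thesis
    using unitary_mat_adjoint[OF W] by (intro exI[of _ "mat_adjoint W"]) simp
qed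

theorem proposition1p2:
  fixes n m :: nat and Z J :: "complex mat" and \<Phi> :: "complex mat \<Rightarrow> complex mat"
  assumes "Z \<in> carrier_mat n n"
    and "psd_mat n J"
    and "positive_linear_map n m \<Phi>"
    and "loewner_le n (mat_abs Z) J"
    and "loewner_le n (mat_abs (mat_adjoint Z)) J"
  shows "\<exists>V. unitary_mat m V \<and>
    loewner_le m (mat_abs (\<Phi> Z))
      ((1 / 2 :: complex) \<cdot>\<^sub>m (\<Phi> J + V * \<Phi> J * mat_adjoint V))"
proof (rule psd_toeplitz_abs_le)
  note Phi = positive_linear_mapD[OF assms(3)]
  show "hermitian_mat m (\<Phi> J)"
    using Phi(3)[OF assms(2)] by (simp add: psd_mat_def)
  show "\<Phi> Z \<in> carrier_mat m m"
    by (rule Phi(1)[OF assms(1)])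
  show "psd_toeplitz m (\<Phi> J) (\<Phi> Z)"
    by (rule positive_map_psd_toeplitz[OF assms(3,2,1) psd_toeplitz_of_abs_le[OF assms(1,4,5)]])
qed

end
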